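(* Let $\Bbbk$ be a nonzero commutative ring. Let $A$ be a precise artinian local ring in $\mathsf{STRing}_{\mathrm{c}}\,\Bbbk$, with residue field $K$. Put on $K$ the fine $A$-module topology. Let $\sigma_1,\sigma_2:K\to A$ be liftings in $\mathsf{STRing}_{\mathrm{c}}\,\Bbbk$ of the canonical surjection $\pi:A\to K$, and assume that $\sigma_2$ is a precise lifting. Let $M_1$ and $M_2$ be finite (i.e. finitely generated) $A$-modules, and let $\phi:M_1\to M_2$ be an $A$-linear homomorphism. For $l=1,2$ choose $K$-linear isomorphisms $\psi_l:K^{r_l}\to\operatorname{rest}_{\sigma_l}(M_l)$. Let $\bar\phi\in\operatorname{Mat}_{r_2\times r_1}(\operatorname{End}_{\Bbbk}(K))$ be the matrix representing the $\Bbbk$-linear homomorphism $\psi_2^{-1}\circ\phi\circ\psi_1:K^{r_1}\to K^{r_2}$. Then the following hold. (1) The matrix $\bar\phi$ belongs to $\operatorname{Mat}_{r_2\times r_1}(\mathcal{D}^{\mathrm{cont}}_{K/\Bbbk})$. (2) Assume that $M_1=M_2$ and $\phi$ is the identity isomorphism. Write $r:=r_1$. Then the matrix $\bar\phi$ belongs to $\operatorname{GL}_r(\mathcal{D}^{\mathrm{cont}}_{K/\Bbbk})$.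
   Context: $\Bbbk$ carries the discrete topology. A $\Bbbk$-linear topology on a $\Bbbk$-module is a module topology in which $0$ has a basis of open neighborhoods consisting of $\Bbbk$-submodules. A commutative semi-topological (ST) $\Bbbk$-ring is a commutative $\Bbbk$-ring $A$ with a $\Bbbk$-linear topology such that for every $a\in A$ the map $A\to A$, $b\mapsto ab$, is continuous. These form the category $\mathsf{STRing}_{\mathrm{c}}\,\Bbbk$, with morphisms the continuous $\Bbbk$-ring homomorphisms. A ST $A$-module is an $A$-module $M$ with a $\Bbbk$-linear topology such that for every $a\in A$, $m\in M$ the maps $M\to M$, $m'\mapsto am'$, and $A\to M$, $a'\mapsto a'm$, are continuous. The fine $A$-module topology on an $A$-module is the finest $\Bbbk$-linear topology making it a ST $A$-module (it exists). Given a ring homomorphism $f:A\to B$ and a $B$-module $M$, the fine $(A,f)$-module topology on $M$ is the fine $A$-module topology on $M$ viewed as an $A$-module via $f$; $\operatorname{rest}_f(M)$ denotes this $A$-module. Let $A$ be an artinian local ring in $\mathsf{STRing}_{\mathrm{c}}\,\Bbbk$ with residue field $K$, with $K$ given the fine $A$-module topology, and let $\pi:A\to K$ be the canonical surjection. A lifting is a continuous $\Bbbk$-ring homomorphism $\sigma:K\to A$ with $\pi\circ\sigma=\mathrm{id}_K$. The lifting $\sigma$ is precise if the given topology of $A$ equals the fine $(K,\sigma)$-module topology on $A$. $A$ is a precise artinian local ring in $\mathsf{STRing}_{\mathrm{c}}\,\Bbbk$ if it admits some precise lifting. $\operatorname{End}^{\mathrm{cont}}_{\Bbbk}(K)$ is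 the ring of continuous $\Bbbk$-linear operators on $K$. The ring of continuous differential operators is $\mathcal{D}^{\mathrm{cont}}_{K/\Bbbk}:=\bigcup_iF_i$, where $F_i:=0$ for $i\le-1$ and, for $i\ge0$, $F_i$ is the set of $\phi\in\operatorname{End}^{\mathrm{cont}}_{\Bbbk}(K)$ such that $a\circ\phi-\phi\circ a\in F_{i-1}$ for all $a\in K$. Elements of $K^r$ are viewed as columns, so $\operatorname{Hom}_{\Bbbk}(K^{r_1},K^{r_2})=\operatorname{Mat}_{r_2\times r_1}(\operatorname{End}_{\Bbbk}(K))$; $\operatorname{GL}_r(B)$ is the group of invertible elements of the matrix ring $\operatorname{Mat}_r(B)$. *)

theory Defs
  imports "HOL-Analysis.Analysis" "HOL-Algebra.Algebra"
begin

section \<open>Modules and algebras\<close>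

text \<open>
  Commutative \<open>k\<close>-rings are records of type \<open>('k, 'a) module\<close> satisfying the library locale
  \<open>algebra k A\<close>; the structure map is \<open>c \<mapsto> c \<odot>\<^bsub>A\<^esub> \<one>\<^bsub>A\<^esub>\<close>. In a record that is used only as a module
  the fields \<open>mult\<close> and \<open>one\<close> carry no meaning.
\<close>

definition rest :: "('b \<Rightarrow> 'a) \<Rightarrow> ('a, 'm) module \<Rightarrow> ('b, 'm) module" where
  "rest f M = \<lparr>carrier = carrier M, monoid.mult = monoid.mult M, one = monoid.one M,
     ring.zero = ring.zero M, ring.add = ring.add M, smult = (\<lambda>b m. f b \<odot>\<^bsub>M\<^esub> m)\<rparr>"

definition self_module :: "('a, 'c) ring_scheme \<Rightarrow> ('a, 'a) module" where
  "self_module R = \<lparr>carrier = carrier R, monoid.mult = monoid.mult R, one = monoid.one R,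
     ring.zero = ring.zero R, ring.add = ring.add R, smult = monoid.mult R\<rparr>"

definition structure_map :: "('k, 'a) module \<Rightarrow> 'k \<Rightarrow> 'a" where
  "structure_map A c = c \<odot>\<^bsub>A\<^esub> \<one>\<^bsub>A\<^esub>"

definition col_module :: "('a, 'c) ring_scheme \<Rightarrow> nat \<Rightarrow> ('a, nat \<Rightarrow> 'a) module" where
  "col_module R r = \<lparr>carrier = {..<r} \<rightarrow>\<^sub>E carrier R,
     monoid.mult = (\<lambda>x y. \<lambda>i\<in>{..<r}. x i \<otimes>\<^bsub>R\<^esub> y i), one = (\<lambda>i\<in>{..<r}. \<one>\<^bsub>R\<^esub>),
     ring.zero = (\<lambda>i\<in>{..<r}. \<zero>\<^bsub>R\<^esub>), ring.add = (\<lambda>x y. \<lambda>i\<in>{..<r}. x i \<oplus>\<^bsub>R\<^esub> y i),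
     smult = (\<lambda>a x. \<lambda>i\<in>{..<r}. a \<otimes>\<^bsub>R\<^esub> x i)\<rparr>"

definition linear_maps :: "('a, 'c) ring_scheme \<Rightarrow> ('a, 'm) module \<Rightarrow> ('a, 'n) module \<Rightarrow> ('m \<Rightarrow> 'n) set" where
  "linear_maps R M N = {f \<in> carrier M \<rightarrow> carrier N.
     (\<forall>x\<in>carrier M. \<forall>y\<in>carrier M. f (x \<oplus>\<^bsub>M\<^esub> y) = f x \<oplus>\<^bsub>N\<^esub> f y) \<and>
     (\<forall>a\<in>carrier R. \<forall>x\<in>carrier M. f (a \<odot>\<^bsub>M\<^esub> x) = a \<odot>\<^bsub>N\<^esub> f x)}"

definition linear_isos :: "('a, 'c) ring_scheme \<Rightarrow> ('a, 'm) module \<Rightarrow> ('a, 'n) module \<Rightarrow> ('m \<Rightarrow> 'n) set" where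
  "linear_isos R M N = {f \<in> linear_maps R M N. bij_betw f (carrier M) (carrier N)}"

definition finite_module :: "('a, 'c) ring_scheme \<Rightarrow> ('a, 'm) module \<Rightarrow> bool" where
  "finite_module R M \<longleftrightarrow> Module.module R M \<and>
     (\<exists>S. finite S \<and> S \<subseteq> carrier M \<and>
        (\<forall>m\<in>carrier M. \<exists>c \<in> S \<rightarrow> carrier R. m = (\<Oplus>\<^bsub>M\<^esub>s\<in>S. c s \<odot>\<^bsub>M\<^esub> s)))"

definition algebra_homs :: "'k ring \<Rightarrow> ('k, 'a) module \<Rightarrow> ('k, 'b) module \<Rightarrow> ('a \<Rightarrow> 'b) set" where
  "algebra_homs k A B = {f \<in> ring_hom A B.
     \<forall>c\<in>carrier k. \<forall>a\<in>carrier A. f (c \<odot>\<^bsub>A\<^esub> a) = c \<odot>\<^bsub>B\<^esub> f a}"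


section \<open>Linear topologies\<close>

text \<open>The ring \<open>k\<close> carries the discrete topology.\<close>

definition linear_topology :: "'k ring \<Rightarrow> ('k, 'm) module \<Rightarrow> 'm topology \<Rightarrow> bool" where
  "linear_topology k M T \<longleftrightarrow> Module.module k M \<and> topspace T = carrier M \<and>
     continuous_map (prod_topology T T) T (\<lambda>(x, y). x \<oplus>\<^bsub>M\<^esub> y) \<and>
     continuous_map (prod_topology (discrete_topology (carrier k)) T) T (\<lambda>(c, x). c \<odot>\<^bsub>M\<^esub> x) \<and>
     (\<forall>U. openin T U \<and> \<zero>\<^bsub>M\<^esub> \<in> U \<longrightarrow> (\<exists>V. submodule V k M \<and> openin T V \<and> V \<subseteq> U))"

definition st_ring :: "'k ring \<Rightarrow> ('k, 'a) module \<Rightarrow> 'a topology \<Rightarrow> bool" where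
  "st_ring k A TA \<longleftrightarrow> algebra k A \<and> linear_topology k A TA \<and>
     (\<forall>a\<in>carrier A. continuous_map TA TA (\<lambda>b. a \<otimes>\<^bsub>A\<^esub> b))"

definition st_module ::
  "'k ring \<Rightarrow> ('k, 'a) module \<Rightarrow> 'a topology \<Rightarrow> ('a, 'm) module \<Rightarrow> 'm topology \<Rightarrow> bool" where
  "st_module k A TA M TM \<longleftrightarrow> Module.module A M \<and>
     linear_topology k (rest (structure_map A) M) TM \<and>
     (\<forall>a\<in>carrier A. continuous_map TM TM (\<lambda>m. a \<odot>\<^bsub>M\<^esub> m)) \<and>
     (\<forall>m\<in>carrier M. continuous_map TA TM (\<lambda>a. a \<odot>\<^bsub>M\<^esub> m))"

definition is_fine_topology ::
  "'k ring \<Rightarrow> ('k, 'a) module \<Rightarrow> 'a topology \<Rightarrow> ('a, 'm) module \<Rightarrow> 'm topology \<Rightarrow> bool" where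
  "is_fine_topology k A TA M TM \<longleftrightarrow> st_module k A TA M TM \<and>
     (\<forall>T. st_module k A TA M T \<longrightarrow> (\<forall>U. openin T U \<longrightarrow> openin TM U))"

definition fine_topology ::
  "'k ring \<Rightarrow> ('k, 'a) module \<Rightarrow> 'a topology \<Rightarrow> ('a, 'm) module \<Rightarrow> 'm topology" where
  "fine_topology k A TA M = (THE TM. is_fine_topology k A TA M TM)"

subsection \<open>Existence and uniqueness of the fine topology\<close>

lemma is_fine_topology_unique:
  assumes "is_fine_topology k A TA M T1" "is_fine_topology k A TA M T2"
  shows "T1 = T2"
  using assms unfolding is_fine_topology_def topology_eq by blast

lemma module_rest_structure_map:
  assumes "algebra k A" "Module.module A M"
  shows "Module.module k (rest (structure_map A) M)"
proof -
  interpret kA: algebra k A by fact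
  interpret AM: Module.module A M by fact
  have ab: "abelian_group (rest (structure_map A) M)"
    by (rule abelian_groupI)
      (auto simp: rest_def AM.M.a_assoc AM.M.a_lcomm AM.M.a_comm intro!: bexI[where x = "\<ominus>\<^bsub>M\<^esub> _"] AM.M.r_neg)
  have mult: "(a \<otimes>\<^bsub>k\<^esub> b) \<odot>\<^bsub>A\<^esub> \<one>\<^bsub>A\<^esub> = (a \<odot>\<^bsub>A\<^esub> \<one>\<^bsub>A\<^esub>) \<otimes>\<^bsub>A\<^esub> (b \<odot>\<^bsub>A\<^esub> \<one>\<^bsub>A\<^esub>)"
    if "a \<in> carrier k" "b \<in> carrier k" for a b
    using that by (simp add: kA.smult_assoc1 kA.smult_assoc2)
  show ?thesis
  proof (rule Module.moduleI)
    show "cring k" by (rule kA.R_cring)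
    show "abelian_group (rest (structure_map A) M)" by (rule ab)
  qed (use mult in \<open>simp_all add: rest_def structure_map_def kA.smult_l_distr AM.smult_l_distr
        AM.smult_r_distr AM.smult_assoc1\<close>)
qed

lemma is_fine_topology_exists:
  fixes k :: "'k ring" and A :: "('k, 'a) module" and M :: "('a, 'm) module"
  assumes alg: "algebra k A" and md: "Module.module A M" and TA: "topspace TA = carrier A"
  shows "\<exists>TM. is_fine_topology k A TA M TM"
proof -
  interpret kA: algebra k A by fact
  interpret AM: Module.module A M by fact
  let ?N = "rest (structure_map A) M"
  interpret kN: Module.module k ?N by (rule module_rest_structure_map[OF alg md])
  have cN: "carrier ?N = carrier M" and aN: "ring.add ?N = ring.add M" and zN: "\<zero>\<^bsub>?N\<^esub> = \<zero>\<^bsub>M\<^esub>"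
    by (simp_all add: rest_def)
  define \<S> where "\<S> = {U. \<exists>T. st_module k A TA M T \<and> openin T U}"
  define TM where "TM = topology_generated_by \<S>"
  have top_st: "topspace T = carrier M" if "st_module k A TA M T" for T
    using that by (simp add: st_module_def linear_topology_def cN)
  define I where "I = topology (\<lambda>U. U = {} \<or> U = carrier M)"
  have oI: "openin I U \<longleftrightarrow> U = {} \<or> U = carrier M" for U
  proof -
    have "istopology (\<lambda>U. U = {} \<or> U = carrier M)"
      unfolding istopology_def by blast
    then show ?thesis by (simp add: I_def)
  qed
  have tI: "topspace I = carrier M"
    unfolding topspace_def oI by auto
  have contI: "continuous_map Z I f" if "f \<in> topspace Z \<rightarrow> carrier M" for Z and f :: "'z \<Rightarrow> 'm"
  proof -
    have "{x \<in> topspace Z. f x \<in> carrier M} = topspace Z" using that by auto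
    then show ?thesis using that by (auto simp: continuous_map_def oI tI)
  qed
  have stI: "st_module k A TA M I"
    unfolding st_module_def linear_topology_def
  proof (intro conjI ballI allI impI)
    show "Module.module A M" by fact
    show "Module.module k ?N" by (rule kN.module_axioms)
    show "topspace I = carrier ?N" by (simp add: tI cN)
    show "continuous_map (prod_topology I I) I (\<lambda>(x, y). x \<oplus>\<^bsub>?N\<^esub> y)"
      by (rule contI) (auto simp: tI aN)
    show "continuous_map (prod_topology (discrete_topology (carrier k)) I) I (\<lambda>(c, x). c \<odot>\<^bsub>?N\<^esub> x)"
      by (rule contI) (use kN.smult_closed cN in \<open>auto simp: tI\<close>)
    show "continuous_map I I (\<lambda>m. a \<odot>\<^bsub>M\<^esub> m)" if "a \<in> carrier A" for a
      by (rule contI) (use that in \<open>auto simp: tI\<close>)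
    show "continuous_map TA I (\<lambda>a. a \<odot>\<^bsub>M\<^esub> m)" if "m \<in> carrier M" for m
      by (rule contI) (use that TA in auto)
    show "\<exists>V. submodule V k ?N \<and> openin I V \<and> V \<subseteq> U" if "openin I U \<and> \<zero>\<^bsub>?N\<^esub> \<in> U" for U
      using that kN.carrier_is_submodule by (auto simp: oI cN)
  qed
  have US: "\<Union>\<S> = carrier M"
  proof
    show "\<Union>\<S> \<subseteq> carrier M"
      unfolding \<S>_def using top_st openin_subset by blast
    have "carrier M \<in> \<S>"
      unfolding \<S>_def using stI oI by blast
    then show "carrier M \<subseteq> \<Union>\<S>" by blast
  qed
  have tTM: "topspace TM = carrier M"
    by (simp add: TM_def US)
  have finer: "openin TM U" if "st_module k A TA M T" "openin T U" for T U
    using that unfolding TM_def \<S>_def by (intro topology_generated_by_Basis) blast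
  have idc: "continuous_map TM T (\<lambda>x. x)" if "st_module k A TA M T" for T
    unfolding continuous_map_def
  proof (intro conjI allI impI)
    show "(\<lambda>x. x) \<in> topspace TM \<rightarrow> topspace T"
      using top_st[OF that] tTM by simp
    fix U assume U: "openin T U"
    then have "{x \<in> topspace TM. x \<in> U} = U"
      using openin_subset[OF U] top_st[OF that] tTM by auto
    then show "openin TM {x \<in> topspace TM. x \<in> U}"
      using finer[OF that U] by simp
  qed
  have cont: "continuous_map Z TM f"
    if "\<And>T. st_module k A TA M T \<Longrightarrow> continuous_map Z T f" for Z and f :: "'z \<Rightarrow> 'm"
    unfolding TM_def
  proof (rule continuous_on_generated_topo)
    show "openin Z (f -` U \<inter> topspace Z)" if U: "U \<in> \<S>" for U
    proof -
      obtain T where "st_module k A TA M T" "openin T U" using U by (auto simp: \<S>_def)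
      then have "openin Z {x \<in> topspace Z. f x \<in> U}"
        using \<open>\<And>T. st_module k A TA M T \<Longrightarrow> continuous_map Z T f\<close>
        by (auto simp: continuous_map_def)
      moreover have "{x \<in> topspace Z. f x \<in> U} = f -` U \<inter> topspace Z" by auto
      ultimately show ?thesis by simp
    qed
    show "f ` topspace Z \<subseteq> \<Union>\<S>"
      using that[OF stI] tI by (auto simp: continuous_map_def US)
  qed
  have nbhd: "\<exists>V. submodule V k ?N \<and> openin TM V \<and> V \<subseteq> U"
    if U: "openin TM U" and z: "\<zero>\<^bsub>?N\<^esub> \<in> U" for U
  proof -
    have "generate_topology_on \<S> U"
      using U unfolding TM_def by (rule openin_topology_generated_by)
    then show ?thesis using z
    proof induction
      case Empty then show ?case by simp
    next
      case (Int a b)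
      then obtain V W where V: "submodule V k ?N" "openin TM V" "V \<subseteq> a"
        and W: "submodule W k ?N" "openin TM W" "W \<subseteq> b" by blast
      have "submodule (V \<inter> W) k ?N"
        using group.subgroups_Inter_pair[OF kN.a_group submodule.axioms(1)[OF V(1)]
            submodule.axioms(1)[OF W(1)]]
          submodule.smult_closed[OF V(1)] submodule.smult_closed[OF W(1)]
        by (simp add: submodule_def submodule_axioms_def)
      then show ?case using V W by (intro exI[of _ "V \<inter> W"]) auto
    next
      case (UN K)
      then obtain b where "b \<in> K" "\<zero>\<^bsub>?N\<^esub> \<in> b" by blast
      with UN.IH obtain V where "submodule V k ?N" "openin TM V" "V \<subseteq> b" by blast
      then show ?case using \<open>b \<in> K\<close> by blast
    next
      case (Basis s)
      then obtain T where "st_module k A TA M T" "openin T s" by (auto simp: \<S>_def)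
      then obtain V where "submodule V k ?N" "openin T V" "V \<subseteq> s"
        using Basis.prems by (auto simp: st_module_def linear_topology_def)
      then show ?case using finer[OF \<open>st_module k A TA M T\<close>] by blast
    qed
  qed
  have "st_module k A TA M TM"
    unfolding st_module_def linear_topology_def
  proof (intro conjI ballI allI impI)
    show "Module.module A M" by fact
    show "Module.module k ?N" by (rule kN.module_axioms)
    show "topspace TM = carrier ?N" by (simp add: tTM cN)
    show "continuous_map (prod_topology TM TM) TM (\<lambda>(x, y). x \<oplus>\<^bsub>?N\<^esub> y)"
    proof (rule cont)
      fix T assume T: "st_module k A TA M T"
      have "continuous_map (prod_topology TM TM) (prod_topology T T) (\<lambda>z. (fst z, snd z))"
        using continuous_map_compose[OF continuous_map_fst idc[OF T], of TM]
          continuous_map_compose[OF continuous_map_snd idc[OF T], of TM]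
        by (intro continuous_map_pairedI) (auto simp: o_def)
      from continuous_map_compose[OF this, of T "\<lambda>(x, y). x \<oplus>\<^bsub>?N\<^esub> y"] T
      show "continuous_map (prod_topology TM TM) T (\<lambda>(x, y). x \<oplus>\<^bsub>?N\<^esub> y)"
        by (auto simp: st_module_def linear_topology_def o_def case_prod_unfold)
    qed
    show "continuous_map (prod_topology (discrete_topology (carrier k)) TM) TM (\<lambda>(c, x). c \<odot>\<^bsub>?N\<^esub> x)"
    proof (rule cont)
      fix T assume T: "st_module k A TA M T"
      let ?D = "discrete_topology (carrier k)"
      have "continuous_map (prod_topology ?D TM) (prod_topology ?D T) (\<lambda>z. (fst z, snd z))"
        using continuous_map_fst[of ?D TM]
          continuous_map_compose[OF continuous_map_snd idc[OF T], of ?D]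
        by (intro continuous_map_pairedI) (auto simp: o_def)
      from continuous_map_compose[OF this, of T "\<lambda>(x, y). x \<odot>\<^bsub>?N\<^esub> y"] T
      show "continuous_map (prod_topology ?D TM) T (\<lambda>(x, y). x \<odot>\<^bsub>?N\<^esub> y)"
        by (auto simp: st_module_def linear_topology_def o_def case_prod_unfold)
    qed
    show "continuous_map TM TM (\<lambda>m. a \<odot>\<^bsub>M\<^esub> m)" if "a \<in> carrier A" for a
    proof (rule cont)
      fix T assume T: "st_module k A TA M T"
      then show "continuous_map TM T (\<lambda>m. a \<odot>\<^bsub>M\<^esub> m)"
        using continuous_map_compose[OF idc[OF T], of T "\<lambda>m. a \<odot>\<^bsub>M\<^esub> m"] that
        by (auto simp: st_module_def o_def)
    qed
    show "continuous_map TA TM (\<lambda>a. a \<odot>\<^bsub>M\<^esub> m)" if "m \<in> carrier M" for m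
      by (rule cont) (use that in \<open>auto simp: st_module_def\<close>)
    show "\<exists>V. submodule V k ?N \<and> openin TM V \<and> V \<subseteq> U" if "openin TM U \<and> \<zero>\<^bsub>?N\<^esub> \<in> U" for U
      using nbhd that by blast
  qed
  then show ?thesis
    unfolding is_fine_topology_def using finer by blast
qed

lemma is_fine_topology_fine_topology:
  assumes "algebra k A" "Module.module A M" "topspace TA = carrier A"
  shows "is_fine_topology k A TA M (fine_topology k A TA M)"
proof -
  have "\<exists>!TM. is_fine_topology k A TA M TM"
    using is_fine_topology_exists[OF assms] is_fine_topology_unique by blast
  then show ?thesis
    unfolding fine_topology_def by (rule theI')
qed


section \<open>Artinian local rings and liftings\<close>

definition artinian_ring :: "('a, 'c) ring_scheme \<Rightarrow> bool" where
  "artinian_ring R \<longleftrightarrow> cring R \<and>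
     (\<forall>I :: nat \<Rightarrow> 'a set. (\<forall>n. ideal (I n) R \<and> I (Suc n) \<subseteq> I n) \<longrightarrow> (\<exists>N. \<forall>n\<ge>N. I n = I N))"

definition local_ring :: "('a, 'c) ring_scheme \<Rightarrow> bool" where
  "local_ring R \<longleftrightarrow> cring R \<and> (\<exists>!I. maximalideal I R)"

definition max_ideal :: "('a, 'c) ring_scheme \<Rightarrow> 'a set" where
  "max_ideal R = (THE I. maximalideal I R)"

text \<open>The library ring \<open>A Quot \<mm>\<close>, with the \<open>k\<close>-algebra structure inherited from \<open>A\<close>.\<close>

definition residue_field :: "('k, 'a) module \<Rightarrow> ('k, 'a set) module" where
  "residue_field A = (let m = max_ideal A; Q = A Quot m in
     \<lparr>carrier = carrier Q, monoid.mult = monoid.mult Q, one = monoid.one Q,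
      ring.zero = ring.zero Q, ring.add = ring.add Q,
      smult = (\<lambda>c C. \<Union>x\<in>C. m +>\<^bsub>A\<^esub> (c \<odot>\<^bsub>A\<^esub> x))\<rparr>)"

definition residue_map :: "('k, 'a) module \<Rightarrow> 'a \<Rightarrow> 'a set" where
  "residue_map A a = max_ideal A +>\<^bsub>A\<^esub> a"

definition fine_topology_via :: "'k ring \<Rightarrow> ('k, 'a) module \<Rightarrow> 'a topology \<Rightarrow> ('a \<Rightarrow> 'b) \<Rightarrow>
    ('b, 'm) module \<Rightarrow> 'm topology" where
  "fine_topology_via k A TA f M = fine_topology k A TA (rest f M)"

definition residue_topology :: "'k ring \<Rightarrow> ('k, 'a) module \<Rightarrow> 'a topology \<Rightarrow> 'a set topology" where
  "residue_topology k A TA =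
     fine_topology_via k A TA (residue_map A) (self_module (residue_field A))"

definition lifting :: "'k ring \<Rightarrow> ('k, 'a) module \<Rightarrow> 'a topology \<Rightarrow> ('a set \<Rightarrow> 'a) \<Rightarrow> bool" where
  "lifting k A TA \<sigma> \<longleftrightarrow> \<sigma> \<in> algebra_homs k (residue_field A) A \<and>
     continuous_map (residue_topology k A TA) TA \<sigma> \<and>
     (\<forall>x\<in>carrier (residue_field A). residue_map A (\<sigma> x) = x)"

definition precise_lifting :: "'k ring \<Rightarrow> ('k, 'a) module \<Rightarrow> 'a topology \<Rightarrow> ('a set \<Rightarrow> 'a) \<Rightarrow> bool" where
  "precise_lifting k A TA \<sigma> \<longleftrightarrow> lifting k A TA \<sigma> \<and>
     TA = fine_topology_via k (residue_field A) (residue_topology k A TA) \<sigma> (self_module A)"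

definition precise_artinian_local_ring :: "'k ring \<Rightarrow> ('k, 'a) module \<Rightarrow> 'a topology \<Rightarrow> bool" where
  "precise_artinian_local_ring k A TA \<longleftrightarrow>
     artinian_ring A \<and> local_ring A \<and> st_ring k A TA \<and> (\<exists>\<sigma>. precise_lifting k A TA \<sigma>)"


section \<open>Continuous differential operators\<close>

text \<open>
  Operators are extensional functions on the carrier, so that equality of operators is equality
  of functions.
\<close>

definition End_ring :: "'k ring \<Rightarrow> ('k, 'b) module \<Rightarrow> ('b \<Rightarrow> 'b) ring" where
  "End_ring k M = \<lparr>carrier = linear_maps k M M \<inter> extensional (carrier M),
     monoid.mult = (\<lambda>f g. compose (carrier M) f g), one = (\<lambda>x\<in>carrier M. x),
     ring.zero = (\<lambda>x\<in>carrier M. \<zero>\<^bsub>M\<^esub>), ring.add = (\<lambda>f g. \<lambda>x\<in>carrier M. f x \<oplus>\<^bsub>M\<^esub> g x)\<rparr>"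

definition End_cont :: "'k ring \<Rightarrow> ('k, 'b) module \<Rightarrow> 'b topology \<Rightarrow> ('b \<Rightarrow> 'b) set" where
  "End_cont k M T = {f \<in> carrier (End_ring k M). continuous_map T T f}"

definition mult_commutator :: "('k, 'b) module \<Rightarrow> 'b \<Rightarrow> ('b \<Rightarrow> 'b) \<Rightarrow> ('b \<Rightarrow> 'b)" where
  "mult_commutator K a f = (\<lambda>x\<in>carrier K. (a \<otimes>\<^bsub>K\<^esub> f x) \<ominus>\<^bsub>K\<^esub> f (a \<otimes>\<^bsub>K\<^esub> x))"

text \<open>The first clause uses \<open>F\<^sub>-\<^sub>1 = 0\<close>; the terms of negative index do not contribute to the union.\<close>

primrec diff_op_filt :: "'k ring \<Rightarrow> ('k, 'b) module \<Rightarrow> 'b topology \<Rightarrow> nat \<Rightarrow> ('b \<Rightarrow> 'b) set" where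
  "diff_op_filt k K T 0 =
     {f \<in> End_cont k K T. \<forall>a\<in>carrier K. mult_commutator K a f \<in> {\<zero>\<^bsub>End_ring k K\<^esub>}}"
| "diff_op_filt k K T (Suc i) =
     {f \<in> End_cont k K T. \<forall>a\<in>carrier K. mult_commutator K a f \<in> diff_op_filt k K T i}"

definition diff_op_ring :: "'k ring \<Rightarrow> ('k, 'b) module \<Rightarrow> 'b topology \<Rightarrow> ('b \<Rightarrow> 'b) ring" where
  "diff_op_ring k K T = (End_ring k K)\<lparr>carrier := (\<Union>i. diff_op_filt k K T i)\<rparr>"


section \<open>Matrices\<close>

definition mats :: "nat \<Rightarrow> nat \<Rightarrow> 'b set \<Rightarrow> (nat \<times> nat \<Rightarrow> 'b) set" where
  "mats m n S = ({..<m} \<times> {..<n}) \<rightarrow>\<^sub>E S"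

definition matrix_ring :: "nat \<Rightarrow> ('b, 'c) ring_scheme \<Rightarrow> (nat \<times> nat \<Rightarrow> 'b) ring" where
  "matrix_ring r B = \<lparr>carrier = mats r r (carrier B),
     monoid.mult = (\<lambda>S T. \<lambda>(i, j)\<in>{..<r} \<times> {..<r}. \<Oplus>\<^bsub>B\<^esub>l\<in>{..<r}. S (i, l) \<otimes>\<^bsub>B\<^esub> T (l, j)),
     one = (\<lambda>(i, j)\<in>{..<r} \<times> {..<r}. if i = j then \<one>\<^bsub>B\<^esub> else \<zero>\<^bsub>B\<^esub>),
     ring.zero = (\<lambda>(i, j)\<in>{..<r} \<times> {..<r}. \<zero>\<^bsub>B\<^esub>),
     ring.add = (\<lambda>S T. \<lambda>(i, j)\<in>{..<r} \<times> {..<r}. S (i, j) \<oplus>\<^bsub>B\<^esub> T (i, j))\<rparr>"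

definition GL :: "nat \<Rightarrow> ('b, 'c) ring_scheme \<Rightarrow> (nat \<times> nat \<Rightarrow> 'b) set" where
  "GL r B = Units (matrix_ring r B)"

text \<open>
  The \<open>(i, j)\<close> entry of the matrix of \<open>\<theta> : K\<^sup>n \<rightarrow> K\<^sup>m\<close> is the composition of the \<open>j\<close>-th
  embedding \<open>K \<rightarrow> K\<^sup>n\<close>, \<open>\<theta>\<close>, and the \<open>i\<close>-th projection \<open>K\<^sup>m \<rightarrow> K\<close>.
\<close>

definition hom_matrix :: "('b, 'c) ring_scheme \<Rightarrow> nat \<Rightarrow> nat \<Rightarrow> ((nat \<Rightarrow> 'b) \<Rightarrow> (nat \<Rightarrow> 'b)) \<Rightarrow>
    (nat \<times> nat \<Rightarrow> 'b \<Rightarrow> 'b)" where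
  "hom_matrix K m n \<theta> = (\<lambda>(i, j)\<in>{..<m} \<times> {..<n}. \<lambda>x\<in>carrier K.
     \<theta> (\<lambda>l\<in>{..<n}. if l = j then x else \<zero>\<^bsub>K\<^esub>) i)"

end

theory Submission
  imports Defs
begin

text \<open>
  An entry of the matrix is \<open>x \<mapsto> p (\<sigma>\<^sub>1 x \<cdot> n)\<close> for some \<open>n \<in> M\<^sub>2\<close> and some \<open>K\<close>-linear
  \<open>p : rest\<^bsub>\<sigma>\<^sub>2\<^esub> M\<^sub>2 \<rightarrow> K\<close>. It is continuous because \<open>a \<mapsto> p (a \<cdot> n)\<close> is \<open>K\<close>-linear on \<open>A\<close>, which carries the
  fine \<open>(K, \<sigma>\<^sub>2)\<close>-module topology. Its commutator with \<open>a \<in> K\<close> is the entry belonging to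
  \<open>(\<sigma>\<^sub>2 a - \<sigma>\<^sub>1 a) \<cdot> n\<close>, and \<open>\<sigma>\<^sub>2 a - \<sigma>\<^sub>1 a\<close> lies in the maximal ideal, which is nilpotent; hence the entry
  is a differential operator.

  The entries \<open>x \<mapsto> q (\<sigma>\<^sub>2 x \<cdot> n)\<close> of the inverse matrix satisfy the same commutator identity, but
  \<open>\<sigma>\<^sub>1\<close> need not be assumed precise, so their continuity is shown by induction on \<open>j\<close> for \<open>n\<close> killed by
  \<open>\<mm>\<^sup>j\<close>: one has \<open>\<sigma>\<^sub>2 x \<cdot> n = \<sigma>\<^sub>1 x \<cdot> n + u x\<close> with \<open>u x\<close> killed by a smaller power of \<open>\<mm>\<close>, and the
  \<open>\<sigma>\<^sub>2\<close>-coordinates of \<open>u x\<close> are continuous in \<open>x\<close> by the first part.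

  The ranks agree because a nonzero functional on an \<open>A\<close>-submodule can be multiplied by an element of
  \<open>A\<close> so that it stays nonzero but vanishes on the multiples by \<open>\<mm>\<close>; it is then linear for both
  liftings, and one passes to its kernel.
\<close>

subsection \<open>Nilpotency of the maximal ideal\<close>

text \<open>Zorn's lemma on the ideals that contain \<open>I\<close> and omit \<open>\<one>\<close>:
  the union of a nonempty chain of them is another one.\<close>

lemma (in cring) ex_maximalideal_containing:
  assumes I: "ideal I R" "\<one> \<notin> I"
  obtains J where "maximalideal J R" "I \<subseteq> J"
proof -
  define S where "S = {J. ideal J R \<and> I \<subseteq> J \<and> \<one> \<notin> J}"
  have "\<exists>J\<in>S. \<forall>L\<in>S. J \<subseteq> L \<longrightarrow> L = J"
  proof (rule subset_Zorn_nonempty)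
    show "S \<noteq> {}" using I unfolding S_def by blast
    fix C assume C: "C \<noteq> {}" "subset.chain S C"
    have "ideal (\<Union>C) R"
      using C(1) C(2) chain_Union_is_ideal[of C]
      unfolding subset_chain_def S_def by auto
    then show "\<Union>C \<in> S" using C unfolding subset_chain_def S_def by blast
  qed
  then obtain J where J: "ideal J R" "I \<subseteq> J" "\<one> \<notin> J"
    and max: "\<And>L. ideal L R \<Longrightarrow> J \<subseteq> L \<Longrightarrow> \<one> \<notin> L \<Longrightarrow> L = J"
    unfolding S_def by (smt (verit) mem_Collect_eq order_trans)
  have "maximalideal J R"
  proof (rule maximalidealI[OF J(1)])
    show "carrier R \<noteq> J" using J(3) by auto
    show "L = J \<or> L = carrier R" if "ideal L R" "J \<subseteq> L" "L \<subseteq> carrier R" for L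
      using max[OF that(1,2)] ideal.one_imp_carrier[OF that(1)] by blast
  qed
  with J(2) that show thesis by blast
qed

lemma max_ideal_maximalideal:
  assumes "local_ring R"
  shows "maximalideal (max_ideal R) R"
  using assms unfolding local_ring_def max_ideal_def by (metis theI')

lemma ideal_subset_max_ideal:
  assumes R: "local_ring R" and I: "ideal I R" "\<one>\<^bsub>R\<^esub> \<notin> I"
  shows "I \<subseteq> max_ideal R"
proof -
  interpret cring R using R by (simp add: local_ring_def)
  obtain J where "maximalideal J R" "I \<subseteq> J" using ex_maximalideal_containing[OF I] .
  then show ?thesis
    using R max_ideal_maximalideal[OF R] unfolding local_ring_def by blast
qed

text \<open>Nakayama's argument for one element: \<open>\<one> \<ominus> c\<close> lies outside the
  maximal ideal of a local ring, hence is invertible, and it kills \<open>x\<close>.\<close>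

lemma zero_if_fixed_by_max_ideal:
  fixes R (structure)
  assumes R: "local_ring R" and c: "c \<in> max_ideal R" and x: "x \<in> carrier R" "c \<otimes> x = x"
  shows "x = \<zero>"
proof -
  interpret cring R using R by (simp add: local_ring_def)
  interpret m: maximalideal "max_ideal R" R by (rule max_ideal_maximalideal[OF R])
  have cR: "c \<in> carrier R" using c m.Icarr by blast
  let ?u = "\<one> \<ominus> c"
  have u: "?u \<in> carrier R" using cR by simp
  have "\<one> \<in> PIdl ?u"
  proof (rule ccontr)
    assume "\<one> \<notin> PIdl ?u"
    then have "?u \<in> max_ideal R"
      using ideal_subset_max_ideal[OF R cgenideal_ideal[OF u]] cgenideal_self[OF u] by blast
    then have "?u \<oplus> c \<in> max_ideal R" using c by simp
    moreover have "?u \<oplus> c = \<one>" using cR by (simp add: a_minus_def a_assoc l_neg)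
    ultimately show False using m.one_imp_carrier m.I_notcarr by simp
  qed
  then obtain v where v: "v \<in> carrier R" "\<one> = v \<otimes> ?u" by (auto simp: cgenideal_def)
  have "?u \<otimes> x = \<zero>" using cR x by (simp add: a_minus_def l_distr l_minus r_neg)
  then have "v \<otimes> ?u \<otimes> x = \<zero>" using v(1) u x(1) by (simp add: m_assoc)
  then show ?thesis using v(2) x(1) by simp
qed

primrec ideal_pow :: "('a, 'c) ring_scheme \<Rightarrow> 'a set \<Rightarrow> nat \<Rightarrow> 'a set" where
  "ideal_pow R I 0 = carrier R"
| "ideal_pow R I (Suc n) = ideal_prod R I (ideal_pow R I n)"

lemma (in ring) ideal_pow_ideal: "ideal I R \<Longrightarrow> ideal (ideal_pow R I n) R"
  by (induction n) (auto intro: oneideal ideal_prod_is_ideal)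

text \<open>The powers of the maximal ideal stabilise at some \<open>P N\<close>. If its annihilator
  \<open>J\<close> were proper, repeated multiplication by elements of the maximal ideal would give
  a sequence outside \<open>J\<close>; the principal ideals of its terms descend and become
  stationary, which forces a term to be zero.\<close>

lemma artinian_local_nilpotent:
  fixes R (structure)
  assumes art: "artinian_ring R" and loc: "local_ring R"
  obtains N where "ideal_pow R (max_ideal R) N = {\<zero>}"
proof -
  interpret cring R using loc by (simp add: local_ring_def)
  interpret m: maximalideal "max_ideal R" R by (rule max_ideal_maximalideal[OF loc])
  define P where "P = ideal_pow R (max_ideal R)"
  have idP: "ideal (P n) R" for n unfolding P_def by (rule ideal_pow_ideal) (rule m.is_ideal)
  have "P (Suc n) \<subseteq> P n" for n
    using ideal_prod_inter[OF m.is_ideal idP[of n]] by (auto simp: P_def)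
  then obtain N where N: "\<forall>n\<ge>N. P n = P N"
    using art idP unfolding artinian_ring_def by blast
  define J where "J = {a \<in> carrier R. \<forall>y\<in>P N. a \<otimes> y = \<zero>}"
  \<comment> \<open>If all these multiples lay in \<open>J\<close>, then \<open>a\<close> would kill
    the product of the maximal ideal with \<open>P N\<close>, which is \<open>P N\<close> again, so
    \<open>a\<close> itself would lie in \<open>J\<close>.\<close>
  have step: "\<exists>c\<in>max_ideal R. c \<otimes> a \<notin> J" if a: "a \<in> carrier R" "a \<notin> J" for a
  proof (rule ccontr)
    assume *: "\<not> ?thesis"
    have "a \<otimes> y = \<zero>" if "y \<in> P (Suc N)" for y
      using that unfolding P_def ideal_pow.simps
    proof (induction rule: ideal_prod.induct)
      case (prod c y)
      then have cy: "c \<in> carrier R" "y \<in> carrier R" "y \<in> P N"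
        using m.Icarr ideal.Icarr[OF idP[of N]] by (auto simp: P_def)
      have "c \<otimes> a \<in> J" using * prod by blast
      then have "c \<otimes> a \<otimes> y = \<zero>" using cy by (simp add: J_def)
      then show ?case using cy a(1) by (simp add: m_assoc m_lcomm)
    next
      case (sum s t)
      then have "s \<in> carrier R" "t \<in> carrier R"
        using ideal.Icarr[OF idP[of "Suc N"]] by (auto simp: P_def)
      with sum.IH a(1) show ?case by (simp add: r_distr)
    qed
    moreover have "P (Suc N) = P N" using N le_SucI by blast
    ultimately show False using a by (auto simp: J_def)
  qed
  have "\<one> \<in> J"
  proof (rule ccontr)
    assume "\<one> \<notin> J"
    have "\<exists>x. \<forall>n. (x n \<in> carrier R \<and> x n \<notin> J) \<and> (\<exists>c\<in>max_ideal R. x (Suc n) = c \<otimes> x n)"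
    proof (rule dependent_nat_choice)
      show "\<exists>x. x \<in> carrier R \<and> x \<notin> J" using \<open>\<one> \<notin> J\<close> by blast
      fix a and n :: nat assume a: "a \<in> carrier R \<and> a \<notin> J"
      then obtain c where "c \<in> max_ideal R" "c \<otimes> a \<notin> J" using step by blast
      then show "\<exists>y. (y \<in> carrier R \<and> y \<notin> J) \<and> (\<exists>c\<in>max_ideal R. y = c \<otimes> a)"
        using a m.Icarr[of c] by (intro exI[of _ "c \<otimes> a"]) auto
    qed
    then obtain x where x: "\<And>n. x n \<in> carrier R" "\<And>n. x n \<notin> J"
      and c: "\<And>n. \<exists>c\<in>max_ideal R. x (Suc n) = c \<otimes> x n" by blast
    have "PIdl (x (Suc n)) \<subseteq> PIdl (x n)" for n
    proof -
      obtain c where "c \<in> carrier R" "x (Suc n) = c \<otimes> x n" using c[of n] m.Icarr by blast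
      then have "x (Suc n) \<in> PIdl (x n)" by (auto simp: cgenideal_def)
      then show ?thesis using cgenideal_minimal[OF cgenideal_ideal[OF x(1)]] by blast
    qed
    then have "\<exists>L. \<forall>n\<ge>L. PIdl (x n) = PIdl (x L)"
      using art[unfolded artinian_ring_def, THEN conjunct2, THEN spec, of "\<lambda>n. PIdl (x n)"]
        cgenideal_ideal[OF x(1)] by blast
    then obtain L where "\<forall>n\<ge>L. PIdl (x n) = PIdl (x L)" by blast
    then have "PIdl (x (Suc L)) = PIdl (x L)" using le_SucI[OF order_refl] by blast
    \<comment> \<open>Stability makes \<open>x L\<close> a multiple of its successor. So
      \<open>x L\<close> is fixed by the element \<open>d \<otimes> c\<close> of the maximal ideal
      and vanishes, although zero lies in \<open>J\<close>.\<close>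
    then have "x L \<in> PIdl (x (Suc L))" using cgenideal_self[OF x(1)[of L]] by simp
    then obtain d where d: "d \<in> carrier R" "x L = d \<otimes> x (Suc L)" by (auto simp: cgenideal_def)
    obtain c where c: "c \<in> max_ideal R" "x (Suc L) = c \<otimes> x L" using c by blast
    then have "d \<otimes> c \<in> max_ideal R" "d \<otimes> c \<otimes> x L = x L"
      using d m.I_l_closed m.Icarr x(1)[of L] by (auto simp: m_assoc)
    then have "x L = \<zero>" using zero_if_fixed_by_max_ideal[OF loc] x(1) by blast
    moreover have "\<zero> \<in> J" using ideal.Icarr[OF idP] by (auto simp: J_def)
    ultimately show False using x(2) by metis
  qed
  then have "y = \<zero>" if "y \<in> P N" for y
    using that ideal.Icarr[OF idP that] by (auto simp: J_def)
  moreover have "\<zero> \<in> P N"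
    using additive_subgroup.zero_closed[OF ideal.axioms(1)[OF idP]] .
  ultimately show thesis using that[of N] unfolding P_def by blast
qed

subsection \<open>Linear maps and the fine topology\<close>

lemma rest_simps [simp]:
  "carrier (rest f M) = carrier M" "ring.zero (rest f M) = ring.zero M"
  "ring.add (rest f M) = ring.add M" "module.smult (rest f M) = (\<lambda>b m. f b \<odot>\<^bsub>M\<^esub> m)"
  "a_inv (rest f M) = a_inv M"
  by (simp_all add: rest_def a_inv_def m_inv_def fun_eq_iff)

lemma self_module_simps [simp]:
  "carrier (self_module R) = carrier R" "ring.zero (self_module R) = ring.zero R"
  "ring.add (self_module R) = ring.add R" "module.smult (self_module R) = monoid.mult R"
  "a_inv (self_module R) = a_inv R"
  by (simp_all add: self_module_def a_inv_def m_inv_def fun_eq_iff)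

lemma linear_maps_zero:
  assumes M: "Module.module R M" and N: "Module.module R N" and f: "f \<in> linear_maps R M N"
  shows "f \<zero>\<^bsub>M\<^esub> = \<zero>\<^bsub>N\<^esub>"
proof -
  interpret M: Module.module R M by fact
  interpret N: Module.module R N by fact
  have "f (\<zero>\<^bsub>R\<^esub> \<odot>\<^bsub>M\<^esub> \<zero>\<^bsub>M\<^esub>) = \<zero>\<^bsub>R\<^esub> \<odot>\<^bsub>N\<^esub> f \<zero>\<^bsub>M\<^esub>"
    using f unfolding linear_maps_def by blast
  moreover have "f \<zero>\<^bsub>M\<^esub> \<in> carrier N" using f by (auto simp: linear_maps_def)
  ultimately show ?thesis by simp
qed

lemma linear_maps_uminus:
  assumes M: "Module.module R M" and N: "Module.module R N" and f: "f \<in> linear_maps R M N"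
    and x: "x \<in> carrier M"
  shows "f (\<ominus>\<^bsub>M\<^esub> x) = \<ominus>\<^bsub>N\<^esub> f x"
proof -
  interpret M: Module.module R M by fact
  interpret N: Module.module R N by fact
  have fx: "f x \<in> carrier N" using f x by (auto simp: linear_maps_def)
  have "f ((\<ominus>\<^bsub>R\<^esub> \<one>\<^bsub>R\<^esub>) \<odot>\<^bsub>M\<^esub> x) = (\<ominus>\<^bsub>R\<^esub> \<one>\<^bsub>R\<^esub>) \<odot>\<^bsub>N\<^esub> f x"
    using f x unfolding linear_maps_def by blast
  then show ?thesis using x fx by (simp add: M.smult_l_minus N.smult_l_minus)
qed

text \<open>The topology on \<open>M\<close> pulled back along \<open>f\<close> makes
  \<open>M\<close> a ST module, so the fine topology is finer than it; this is continuity of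
  \<open>f\<close>.\<close>

lemma linear_map_continuous_fine:
  assumes alg: "algebra k A" and fine: "is_fine_topology k A TA M TM"
    and TA: "topspace TA = carrier A" and N: "st_module k A TA N TN" and f: "f \<in> linear_maps A M N"
  shows "continuous_map TM TN f"
proof -
  interpret kA: algebra k A by fact
  have M: "st_module k A TA M TM" using fine by (simp add: is_fine_topology_def)
  interpret M: Module.module A M using M by (simp add: st_module_def)
  interpret N: Module.module A N using N by (simp add: st_module_def)
  interpret kM: Module.module k "rest (structure_map A) M"
    by (rule module_rest_structure_map[OF alg M.module_axioms])
  interpret kN: Module.module k "rest (structure_map A) N"
    by (rule module_rest_structure_map[OF alg N.module_axioms])
  note tN = N[unfolded st_module_def linear_topology_def, simplified]
  have fM: "f x \<in> carrier N" if "x \<in> carrier M" for x using f that by (auto simp: linear_maps_def)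
  have f_add: "f (x \<oplus>\<^bsub>M\<^esub> y) = f x \<oplus>\<^bsub>N\<^esub> f y" if "x \<in> carrier M" "y \<in> carrier M" for x y
    using f that by (auto simp: linear_maps_def)
  have f_smult: "f (a \<odot>\<^bsub>M\<^esub> x) = a \<odot>\<^bsub>N\<^esub> f x" if "a \<in> carrier A" "x \<in> carrier M" for a x
    using f that by (auto simp: linear_maps_def)
  have f0: "f \<zero>\<^bsub>M\<^esub> = \<zero>\<^bsub>N\<^esub>" by (rule linear_maps_zero[OF M.module_axioms N.module_axioms f])
  have sm: "structure_map A c \<in> carrier A" if "c \<in> carrier k" for c
    using that by (simp add: structure_map_def)
  define T where "T = pullback_topology (carrier M) f TN"
  have tT: "topspace T = carrier M"
    using tN fM by (auto simp: T_def topspace_pullback_topology)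
  have fT: "continuous_map T TN f"
    using continuous_map_pullback[OF continuous_map_id, of "carrier M" f TN] by (simp add: T_def)
  \<comment> \<open>Universal property of the pullback: the continuity axioms for \<open>M\<close>
    reduce to those for \<open>N\<close> after composing with \<open>f\<close>.\<close>
  have into: "continuous_map Z T g"
    if "continuous_map Z TN h" "\<And>z. z \<in> topspace Z \<Longrightarrow> g z \<in> carrier M"
      "\<And>z. z \<in> topspace Z \<Longrightarrow> f (g z) = h z" for Z :: "'z topology" and g h
    unfolding T_def
  proof (rule continuous_map_pullback')
    show "continuous_map Z TN (f \<circ> g)"
      by (rule continuous_map_eq[OF that(1)]) (simp add: that(3))
  qed (use that(2) in auto)
  have "st_module k A TA M T"
    unfolding st_module_def linear_topology_def
  proof (intro conjI ballI allI impI)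
    show "Module.module A M" by (rule M.module_axioms)
    show "Module.module k (rest (structure_map A) M)" by (rule kM.module_axioms)
    show "topspace T = carrier (rest (structure_map A) M)" by (simp add: tT)
    show "continuous_map (prod_topology T T) T (\<lambda>(x, y). x \<oplus>\<^bsub>rest (structure_map A) M\<^esub> y)"
    proof (rule into)
      have "continuous_map (prod_topology T T) (prod_topology TN TN) (\<lambda>z. (f (fst z), f (snd z)))"
        using continuous_map_compose[OF continuous_map_fst fT] continuous_map_compose[OF continuous_map_snd fT]
        by (intro continuous_map_pairedI) (auto simp: o_def)
      from continuous_map_compose[OF this, of TN "\<lambda>(x, y). x \<oplus>\<^bsub>N\<^esub> y"]
      show "continuous_map (prod_topology T T) TN (\<lambda>z. f (fst z) \<oplus>\<^bsub>N\<^esub> f (snd z))"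
        using tN by (simp add: o_def)
    qed (auto simp: tT f_add)
    show "continuous_map (prod_topology (discrete_topology (carrier k)) T) T
        (\<lambda>(c, x). c \<odot>\<^bsub>rest (structure_map A) M\<^esub> x)"
    proof (rule into)
      have "continuous_map (prod_topology (discrete_topology (carrier k)) T)
          (prod_topology (discrete_topology (carrier k)) TN) (\<lambda>z. (fst z, f (snd z)))"
        using continuous_map_compose[OF continuous_map_snd fT]
        by (intro continuous_map_pairedI continuous_map_fst) (auto simp: o_def)
      from continuous_map_compose[OF this, of TN "\<lambda>(c, x). structure_map A c \<odot>\<^bsub>N\<^esub> x"]
      show "continuous_map (prod_topology (discrete_topology (carrier k)) T) TN
          (\<lambda>z. structure_map A (fst z) \<odot>\<^bsub>N\<^esub> f (snd z))"
        using tN by (simp add: o_def)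
    qed (auto simp: tT f_smult sm)
    show "\<exists>V. submodule V k (rest (structure_map A) M) \<and> openin T V \<and> V \<subseteq> U"
      if U: "openin T U \<and> \<zero>\<^bsub>rest (structure_map A) M\<^esub> \<in> U" for U
    proof -
      obtain U' where U': "openin TN U'" "U = f -` U' \<inter> carrier M"
        using U by (auto simp: T_def openin_pullback_topology)
      then have "\<zero>\<^bsub>N\<^esub> \<in> U'" using U f0 by auto
      then obtain V where V: "submodule V k (rest (structure_map A) N)" "openin TN V" "V \<subseteq> U'"
        using tN U'(1) by blast
      have "submodule (f -` V \<inter> carrier M) k (rest (structure_map A) M)"
        using kN.submoduleE[OF V(1)] submodule.axioms(1)[OF V(1)]
        by (intro kM.submoduleI)
          (auto simp: f0 f_add f_smult sm linear_maps_uminus[OF M.module_axioms N.module_axioms f]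
            dest: subgroup.one_closed)
      moreover have "openin T (f -` V \<inter> carrier M)"
        using V(2) by (auto simp: T_def openin_pullback_topology)
      ultimately show ?thesis using V(3) U'(2) by blast
    qed
    show "continuous_map T T ((\<odot>\<^bsub>M\<^esub>) a)" if a: "a \<in> carrier A" for a
    proof (rule into)
      show "continuous_map T TN (\<lambda>x. a \<odot>\<^bsub>N\<^esub> f x)"
        using continuous_map_compose[OF fT, of TN "\<lambda>x. a \<odot>\<^bsub>N\<^esub> x"] tN a by (simp add: o_def)
    qed (use a in \<open>auto simp: tT f_smult\<close>)
    show "continuous_map TA T (\<lambda>a. a \<odot>\<^bsub>M\<^esub> m)" if m: "m \<in> carrier M" for m
    proof (rule into)
      show "continuous_map TA TN (\<lambda>a. a \<odot>\<^bsub>N\<^esub> f m)" using tN m fM by simp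
    qed (use m TA f_smult in auto)
  qed
  then have "openin TM U" if "openin T U" for U using fine that by (auto simp: is_fine_topology_def)
  moreover have "topspace TM = carrier M" using M by (simp add: st_module_def linear_topology_def)
  ultimately show ?thesis
    using tN fM unfolding continuous_map_alt T_def openin_pullback_topology by auto
qed

text \<open>Serves to compare the \<open>k\<close>-module structures induced through two different
  algebras; these are only known to agree for scalars in \<open>carrier k\<close>.\<close>

lemma linear_topology_cong:
  assumes M: "linear_topology k M T" and N: "Module.module k N"
    and eq: "carrier N = carrier M" "ring.zero N = ring.zero M" "ring.add N = ring.add M"
      "\<And>c x. c \<in> carrier k \<Longrightarrow> x \<in> carrier M \<Longrightarrow> c \<odot>\<^bsub>N\<^esub> x = c \<odot>\<^bsub>M\<^esub> x"
  shows "linear_topology k N T"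
proof -
  note tM = M[unfolded linear_topology_def]
  have sub: "submodule V k N" if "submodule V k M" for V
  proof -
    have "V \<subseteq> carrier M" using Module.module.submoduleE(1)[OF _ that] tM by blast
    then show ?thesis
      using that by (auto simp: submodule_def submodule_axioms_def eq subset_iff)
  qed
  have "continuous_map (prod_topology (discrete_topology (carrier k)) T) T (\<lambda>(c, x). c \<odot>\<^bsub>N\<^esub> x)"
    by (rule continuous_map_eq[where f = "\<lambda>(c, x). c \<odot>\<^bsub>M\<^esub> x"]) (use tM eq(4) in auto)
  then show ?thesis
    using tM N sub unfolding linear_topology_def eq by blast
qed

section \<open>Restriction of scalars and the topology of a quotient ring\<close>

lemma module_rest_ring_hom:
  assumes A: "cring A" and B: "cring B" and f: "f \<in> ring_hom A B" and M: "Module.module B M"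
  shows "Module.module A (rest f M)"
proof -
  interpret A: cring A by fact
  interpret M: Module.module B M by fact
  have "abelian_group (rest f M)"
    by (rule abelian_groupI)
      (auto simp: M.M.a_assoc M.M.a_lcomm M.M.a_comm intro!: bexI[where x = "\<ominus>\<^bsub>M\<^esub> _"] M.M.r_neg)
  then show ?thesis
    using ring_hom_closed[OF f]
    by (intro Module.moduleI)
      (auto simp: A.is_cring ring_hom_add[OF f] ring_hom_mult[OF f] ring_hom_one[OF f]
        M.smult_l_distr M.smult_r_distr M.smult_assoc1)
qed

lemma module_self_module:
  assumes "cring R"
  shows "Module.module R (self_module R)"
proof -
  interpret R: cring R by fact
  have "abelian_group (self_module R)"
    by (rule abelian_groupI)
      (auto simp: R.a_assoc R.a_lcomm R.a_comm intro!: bexI[where x = "\<ominus>\<^bsub>R\<^esub> _"] R.r_neg)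
  then show ?thesis
    by (intro Module.moduleI) (auto simp: R.is_cring R.l_distr R.r_distr R.m_assoc)
qed

text \<open>By surjectivity, multiplication by an element of \<open>B\<close> is multiplication by
  an element of \<open>A\<close>; commutativity gives continuity in the other factor. For the
  residue map it shows that the fine \<open>A\<close>-module topology turns the residue field into a
  ST ring.\<close>

lemma st_module_self_quotient:
  assumes A: "algebra k A" and B: "algebra k B" and f: "f \<in> algebra_homs k A B"
    and surj: "f ` carrier A = carrier B"
    and T: "st_module k A TA (rest f (self_module B)) T"
  shows "st_module k B T (self_module B) T"
proof -
  interpret A: algebra k A by fact
  interpret B: algebra k B by fact
  have fk: "\<And>c. c \<in> carrier k \<Longrightarrow> f (c \<odot>\<^bsub>A\<^esub> \<one>\<^bsub>A\<^esub>) = c \<odot>\<^bsub>B\<^esub> \<one>\<^bsub>B\<^esub>"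
    using f ring_hom_one[of f A B] by (auto simp: algebra_homs_def)
  note tT = T[unfolded st_module_def, simplified]
  have mB: "Module.module B (self_module B)" by (rule module_self_module) (rule B.M_cring)
  have lin: "linear_topology k (rest (structure_map B) (self_module B)) T"
    by (rule linear_topology_cong[OF _ module_rest_structure_map[OF B mB],
          of "rest (structure_map A) (rest f (self_module B))"])
      (use tT in \<open>simp_all add: structure_map_def fk\<close>)
  have mult: "continuous_map T T (\<lambda>x. b \<otimes>\<^bsub>B\<^esub> x)" if b: "b \<in> carrier B" for b
  proof -
    obtain a where "a \<in> carrier A" "b = f a" using b surj by blast
    moreover have "\<forall>a\<in>carrier A. continuous_map T T (\<lambda>x. f a \<otimes>\<^bsub>B\<^esub> x)"
      using T by (simp add: st_module_def)
    ultimately show ?thesis by simp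
  qed
  have tT': "topspace T = carrier B" using lin by (simp add: linear_topology_def)
  have "continuous_map T T (\<lambda>x. x \<otimes>\<^bsub>B\<^esub> b)" if "b \<in> carrier B" for b
    by (rule continuous_map_eq[OF mult[OF that]]) (simp add: tT' that B.m_comm)
  with mB lin mult show ?thesis by (simp add: st_module_def)
qed

subsection \<open>The ring of continuous differential operators\<close>

text \<open>That \<open>K\<close> is a ST ring is expressed as being a ST module over itself, the
  form in which \<open>linear_map_continuous_fine\<close> takes its target.\<close>

locale st_algebra =
  fixes k :: "'k ring" and K :: "('k, 'b) module" (structure) and TK :: "'b topology"
  assumes alg: "algebra k K"
    and st: "st_module k K TK (self_module K) TK"
begin

sublocale K: cring K using alg by (rule algebra.M_cring)
sublocale kK: Module.module k K using alg by (rule algebra.axioms(1))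

abbreviation "E \<equiv> End_ring k K"
abbreviation "F \<equiv> diff_op_filt k K TK"
abbreviation "D \<equiv> diff_op_ring k K TK"

lemma topspace_TK: "topspace TK = carrier K"
  using st by (simp add: st_module_def linear_topology_def)

lemma continuous_mult: "a \<in> carrier K \<Longrightarrow> continuous_map TK TK (\<lambda>x. x \<otimes> a)"
  using st by (simp add: st_module_def)

lemma continuous_add:
  assumes f: "continuous_map Z TK f" and g: "continuous_map Z TK g"
  shows "continuous_map Z TK (\<lambda>z. f z \<oplus> g z)"
proof -
  have "continuous_map (prod_topology TK TK) TK (\<lambda>(x, y). x \<oplus> y)"
    using st by (simp add: st_module_def linear_topology_def)
  from continuous_map_compose[OF continuous_map_pairedI[OF f g] this]
  show ?thesis by (simp add: o_def)
qed

lemma continuous_zero: "continuous_map Z TK (\<lambda>z. \<zero>)"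
  using K.zero_closed unfolding topspace_TK[symmetric] by simp

lemma continuous_finsum:
  assumes "finite S" "\<And>l. l \<in> S \<Longrightarrow> continuous_map Z TK (f l)"
  shows "continuous_map Z TK (\<lambda>z. \<Oplus>l\<in>S. f l z)"
  using assms
proof (induction S rule: finite_induct)
  case empty
  then show ?case by (simp add: continuous_zero del: continuous_map_const)
next
  case (insert i S)
  have car: "f l z \<in> carrier K" if "l \<in> insert i S" "z \<in> topspace Z" for l z
    using continuous_map_funspace[OF insert.prems] that topspace_TK by (auto simp: Pi_iff)
  have "continuous_map Z TK (\<lambda>z. f i z \<oplus> (\<Oplus>l\<in>S. f l z))"
    using insert by (intro continuous_add) auto
  then show ?case
    by (rule continuous_map_eq) (use insert.hyps car in \<open>auto simp: K.finsum_insert Pi_iff\<close>)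
qed

section \<open>Continuous linear operators\<close>

lemma End_contI:
  assumes "\<And>x. x \<in> carrier K \<Longrightarrow> f x \<in> carrier K"
    and "\<And>x y. x \<in> carrier K \<Longrightarrow> y \<in> carrier K \<Longrightarrow> f (x \<oplus> y) = f x \<oplus> f y"
    and "\<And>c x. c \<in> carrier k \<Longrightarrow> x \<in> carrier K \<Longrightarrow> f (c \<odot>\<^bsub>K\<^esub> x) = c \<odot>\<^bsub>K\<^esub> f x"
    and "continuous_map TK TK f"
  shows "(\<lambda>x\<in>carrier K. f x) \<in> End_cont k K TK"
proof -
  have "continuous_map TK TK (\<lambda>x\<in>carrier K. f x)"
    by (rule continuous_map_eq[OF assms(4)]) (simp add: topspace_TK)
  with assms(1-3) show ?thesis
    by (auto simp: End_cont_def End_ring_def linear_maps_def)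
qed

lemma End_contD:
  assumes "f \<in> End_cont k K TK"
  shows "\<And>x. x \<in> carrier K \<Longrightarrow> f x \<in> carrier K"
    and "\<And>x y. x \<in> carrier K \<Longrightarrow> y \<in> carrier K \<Longrightarrow> f (x \<oplus> y) = f x \<oplus> f y"
    and "\<And>c x. c \<in> carrier k \<Longrightarrow> x \<in> carrier K \<Longrightarrow> f (c \<odot>\<^bsub>K\<^esub> x) = c \<odot>\<^bsub>K\<^esub> f x"
    and "continuous_map TK TK f"
    and "f \<in> extensional (carrier K)"
    and "\<And>x y. x \<in> carrier K \<Longrightarrow> y \<in> carrier K \<Longrightarrow> f (x \<ominus> y) = f x \<ominus> f y"
proof -
  show *: "\<And>x. x \<in> carrier K \<Longrightarrow> f x \<in> carrier K"
    and **: "\<And>x y. x \<in> carrier K \<Longrightarrow> y \<in> carrier K \<Longrightarrow> f (x \<oplus> y) = f x \<oplus> f y"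
    and "\<And>c x. c \<in> carrier k \<Longrightarrow> x \<in> carrier K \<Longrightarrow> f (c \<odot>\<^bsub>K\<^esub> x) = c \<odot>\<^bsub>K\<^esub> f x"
    and "continuous_map TK TK f"
    and "f \<in> extensional (carrier K)"
    using assms by (auto simp: End_cont_def End_ring_def linear_maps_def)
  have "f \<in> linear_maps k K K" using assms by (auto simp: End_cont_def End_ring_def)
  then have um: "f (\<ominus> y) = \<ominus> f y" if "y \<in> carrier K" for y
    by (rule linear_maps_uminus[OF kK.module_axioms kK.module_axioms _ that])
  show "f (x \<ominus> y) = f x \<ominus> f y" if "x \<in> carrier K" "y \<in> carrier K" for x y
    unfolding a_minus_def using **[OF that(1) K.a_inv_closed[OF that(2)]] um[OF that(2)] by simp
qed

section \<open>The filtration by order\<close>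

lemma filt_End_cont: "f \<in> F i \<Longrightarrow> f \<in> End_cont k K TK"
  by (cases i) auto

lemma zero_filt: "\<zero>\<^bsub>E\<^esub> \<in> F i"
proof -
  have Z: "\<zero>\<^bsub>E\<^esub> \<in> End_cont k K TK"
    unfolding End_ring_def ring.simps
    by (rule End_contI) (simp_all add: continuous_zero del: continuous_map_const)
  have "mult_commutator K a \<zero>\<^bsub>E\<^esub> = \<zero>\<^bsub>E\<^esub>" if "a \<in> carrier K" for a
    using that by (auto simp: mult_commutator_def End_ring_def a_minus_def fun_eq_iff)
  with Z show ?thesis by (induction i) auto
qed

text \<open>The zero operator, sole member of the term of index -1, lies in \<open>F 0\<close>; the
  inclusion then propagates to higher orders through commutators.\<close>

lemma filt_Suc: "f \<in> F i \<Longrightarrow> f \<in> F (Suc i)"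
proof (induction i arbitrary: f)
  case 0
  then show ?case using zero_filt[of 0] by auto
qed auto

lemma filt_mono: "i \<le> j \<Longrightarrow> f \<in> F i \<Longrightarrow> f \<in> F j"
  by (induction j rule: dec_induct) (auto simp del: diff_op_filt.simps intro: filt_Suc)

lemma add_zero_zero: "\<zero>\<^bsub>E\<^esub> \<oplus>\<^bsub>E\<^esub> \<zero>\<^bsub>E\<^esub> = \<zero>\<^bsub>E\<^esub>"
  by (auto simp: End_ring_def)

lemma End_cont_add:
  assumes f: "f \<in> End_cont k K TK" and g: "g \<in> End_cont k K TK"
  shows "f \<oplus>\<^bsub>E\<^esub> g \<in> End_cont k K TK"
  unfolding End_ring_def ring.simps
proof (rule End_contI)
  note fc = End_contD[OF f] and gc = End_contD[OF g]
  show "f x \<oplus> g x \<in> carrier K" if "x \<in> carrier K" for x using that fc(1) gc(1) by simp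
  show "f (x \<oplus> y) \<oplus> g (x \<oplus> y) = f x \<oplus> g x \<oplus> (f y \<oplus> g y)"
    if "x \<in> carrier K" "y \<in> carrier K" for x y
    using fc(1)[OF that(1)] fc(1)[OF that(2)] gc(1)[OF that(1)] gc(1)[OF that(2)]
    by (simp add: fc(2)[OF that] gc(2)[OF that] K.a_ac)
  show "f (c \<odot>\<^bsub>K\<^esub> x) \<oplus> g (c \<odot>\<^bsub>K\<^esub> x) = c \<odot>\<^bsub>K\<^esub> (f x \<oplus> g x)"
    if "c \<in> carrier k" "x \<in> carrier K" for c x
    using fc(1)[OF that(2)] gc(1)[OF that(2)] that(1)
    by (simp add: fc(3)[OF that] gc(3)[OF that] kK.smult_r_distr)
  show "continuous_map TK TK (\<lambda>x. f x \<oplus> g x)" by (rule continuous_add[OF fc(4) gc(4)])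
qed

lemma mult_commutator_add:
  assumes f: "f \<in> End_cont k K TK" and g: "g \<in> End_cont k K TK" and a: "a \<in> carrier K"
  shows "mult_commutator K a (f \<oplus>\<^bsub>E\<^esub> g) = mult_commutator K a f \<oplus>\<^bsub>E\<^esub> mult_commutator K a g"
proof
  fix x
  have *: "a \<otimes> (u \<oplus> v) \<ominus> (u' \<oplus> v') = (a \<otimes> u \<ominus> u') \<oplus> (a \<otimes> v \<ominus> v')"
    if "u \<in> carrier K" "v \<in> carrier K" "u' \<in> carrier K" "v' \<in> carrier K" for u v u' v'
    using that a by (simp add: a_minus_def K.r_distr K.minus_add K.a_ac)
  show "mult_commutator K a (f \<oplus>\<^bsub>E\<^esub> g) x = (mult_commutator K a f \<oplus>\<^bsub>E\<^esub> mult_commutator K a g) x"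
    using * End_contD(1)[OF f] End_contD(1)[OF g] a
    by (simp add: mult_commutator_def End_ring_def)
qed

lemma filt_add: "f \<in> F i \<Longrightarrow> g \<in> F i \<Longrightarrow> f \<oplus>\<^bsub>E\<^esub> g \<in> F i"
proof (induction i arbitrary: f g)
  case 0
  then show ?case by (simp add: End_cont_add mult_commutator_add add_zero_zero)
next
  case (Suc i)
  then show ?case by (simp add: End_cont_add mult_commutator_add)
qed

lemma End_cont_mult:
  assumes f: "f \<in> End_cont k K TK" and g: "g \<in> End_cont k K TK"
  shows "f \<otimes>\<^bsub>E\<^esub> g \<in> End_cont k K TK"
  unfolding End_ring_def monoid.simps compose_def
proof (rule End_contI)
  note fc = End_contD[OF f] and gc = End_contD[OF g]
  show "f (g x) \<in> carrier K" if "x \<in> carrier K" for x using that fc(1) gc(1) by simp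
  show "f (g (x \<oplus> y)) = f (g x) \<oplus> f (g y)" if "x \<in> carrier K" "y \<in> carrier K" for x y
    by (simp add: gc(2)[OF that] fc(2) gc(1) that)
  show "f (g (c \<odot>\<^bsub>K\<^esub> x)) = c \<odot>\<^bsub>K\<^esub> f (g x)" if "c \<in> carrier k" "x \<in> carrier K" for c x
    by (simp add: gc(3)[OF that] fc(3) gc(1) that)
  show "continuous_map TK TK (\<lambda>x. f (g x))"
    using continuous_map_compose[OF gc(4) fc(4)] by (simp add: o_def)
qed

text \<open>Leibniz rule: the commutator with \<open>a\<close> is a derivation. The intermediate
  term \<open>f (a \<otimes> g x)\<close> is inserted and cancels.\<close>

lemma mult_commutator_mult:
  assumes f: "f \<in> End_cont k K TK" and g: "g \<in> End_cont k K TK" and a: "a \<in> carrier K"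
  shows "mult_commutator K a (f \<otimes>\<^bsub>E\<^esub> g) =
    (mult_commutator K a f \<otimes>\<^bsub>E\<^esub> g) \<oplus>\<^bsub>E\<^esub> (f \<otimes>\<^bsub>E\<^esub> mult_commutator K a g)"
proof
  fix x
  show "mult_commutator K a (f \<otimes>\<^bsub>E\<^esub> g) x =
    ((mult_commutator K a f \<otimes>\<^bsub>E\<^esub> g) \<oplus>\<^bsub>E\<^esub> (f \<otimes>\<^bsub>E\<^esub> mult_commutator K a g)) x"
  proof (cases "x \<in> carrier K")
    case True
    note fc = End_contD[OF f] and gc = End_contD[OF g]
    have "(u \<ominus> v) \<oplus> (v \<ominus> w) = u \<ominus> w" if "u \<in> carrier K" "v \<in> carrier K" "w \<in> carrier K" for u v w
      using that by (simp add: a_minus_def K.a_assoc K.r_neg1)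
    with True a fc(1,6) gc(1) show ?thesis
      by (simp add: mult_commutator_def End_ring_def compose_eq)
  qed (simp add: mult_commutator_def End_ring_def)
qed

lemma zero_mult: "g \<in> End_cont k K TK \<Longrightarrow> \<zero>\<^bsub>E\<^esub> \<otimes>\<^bsub>E\<^esub> g = \<zero>\<^bsub>E\<^esub>"
  using End_contD(1)[of g] by (simp add: End_ring_def compose_def cong: restrict_cong)

lemma mult_zero:
  assumes f: "f \<in> End_cont k K TK"
  shows "f \<otimes>\<^bsub>E\<^esub> \<zero>\<^bsub>E\<^esub> = \<zero>\<^bsub>E\<^esub>"
proof -
  have "f \<zero> = \<zero>"
    using End_contD(6)[OF f, of \<zero> \<zero>] End_contD(1)[OF f, of \<zero>] by (simp add: a_minus_def K.r_neg)
  then show ?thesis by (simp add: End_ring_def compose_def cong: restrict_cong)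
qed

text \<open>By the Leibniz rule the commutator of a product is a sum of two products of total order
  one less, so the induction runs on \<open>i + j\<close>.\<close>

lemma filt_mult: "f \<in> F i \<Longrightarrow> g \<in> F j \<Longrightarrow> f \<otimes>\<^bsub>E\<^esub> g \<in> F (i + j)"
proof (induction n \<equiv> "i + j" arbitrary: i j f g)
  case 0
  then have ij: "i = 0" "j = 0" by auto
  have "mult_commutator K a (f \<otimes>\<^bsub>E\<^esub> g) = \<zero>\<^bsub>E\<^esub>" if a: "a \<in> carrier K" for a
  proof -
    have "mult_commutator K a f = \<zero>\<^bsub>E\<^esub>" "mult_commutator K a g = \<zero>\<^bsub>E\<^esub>"
      using "0.prems" a by (simp_all add: ij)
    then show ?thesis
      using filt_End_cont[OF "0.prems"(1)] filt_End_cont[OF "0.prems"(2)] a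
      by (simp add: mult_commutator_mult zero_mult mult_zero add_zero_zero)
  qed
  then show ?case
    using End_cont_mult[OF filt_End_cont[OF "0.prems"(1)] filt_End_cont[OF "0.prems"(2)]]
    by (simp add: ij)
next
  case (Suc n)
  note f = filt_End_cont[OF Suc.prems(1)] and g = filt_End_cont[OF Suc.prems(2)]
  have "mult_commutator K a (f \<otimes>\<^bsub>E\<^esub> g) \<in> F n" if a: "a \<in> carrier K" for a
  proof -
    have "mult_commutator K a f \<otimes>\<^bsub>E\<^esub> g \<in> F n"
    \<comment> \<open>The indices are natural numbers, so order zero is treated apart: the
      commutator is then the zero operator and the summand vanishes.\<close>
    proof (cases i)
      case 0
      then show ?thesis using Suc.prems a zero_mult[OF g] zero_filt[of n] by simp
    next
      case (Suc i')
      then have "mult_commutator K a f \<in> F i'" using Suc.prems a by simp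
      then show ?thesis using Suc.hyps(1)[of i' j] Suc.hyps(2) Suc Suc.prems(2) by simp
    qed
    moreover have "f \<otimes>\<^bsub>E\<^esub> mult_commutator K a g \<in> F n"
    proof (cases j)
      case 0
      then show ?thesis using Suc.prems a mult_zero[OF f] zero_filt[of n] by simp
    next
      case (Suc j')
      then have "mult_commutator K a g \<in> F j'" using Suc.prems a by simp
      then show ?thesis using Suc.hyps(1)[of i j'] Suc.hyps(2) Suc Suc.prems(1) by simp
    qed
    ultimately show ?thesis using mult_commutator_mult[OF f g a] filt_add by simp
  qed
  with Suc.hyps(2) show ?case using End_cont_mult[OF f g] by (simp flip: Suc.hyps(2))
qed

section \<open>Sums and products in the ring of differential operators\<close>

lemma diff_op_ring_simps:
  "carrier D = (\<Union>i. F i)" "monoid.mult D = monoid.mult E" "one D = one E"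
  "ring.zero D = ring.zero E" "ring.add D = ring.add E"
  by (simp_all add: diff_op_ring_def)

lemma diff_op_End_cont: "f \<in> carrier D \<Longrightarrow> f \<in> End_cont k K TK"
  unfolding diff_op_ring_simps using filt_End_cont by blast

lemma diff_op_mult: "f \<in> carrier D \<Longrightarrow> g \<in> carrier D \<Longrightarrow> f \<otimes>\<^bsub>D\<^esub> g \<in> carrier D"
  unfolding diff_op_ring_simps using filt_mult by blast

text \<open>Supplies the finite sums in the matrix product over \<open>D\<close>. Two operators are
  added inside a common term of the filtration, that of index \<open>max i j\<close>.\<close>

sublocale D: abelian_monoid D
proof (rule abelian_monoidI)
  show "\<zero>\<^bsub>D\<^esub> \<in> carrier D" unfolding diff_op_ring_simps using zero_filt by blast
  fix f g assume f: "f \<in> carrier D" and g: "g \<in> carrier D"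
  then obtain i j where "f \<in> F i" "g \<in> F j" unfolding diff_op_ring_simps by blast
  then have "f \<in> F (max i j)" "g \<in> F (max i j)" by (meson filt_mono max.cobounded1 max.cobounded2)+
  then show "f \<oplus>\<^bsub>D\<^esub> g \<in> carrier D" unfolding diff_op_ring_simps using filt_add by blast
  note fc = End_contD[OF diff_op_End_cont[OF f]] and gc = End_contD[OF diff_op_End_cont[OF g]]
  show "f \<oplus>\<^bsub>D\<^esub> g = g \<oplus>\<^bsub>D\<^esub> f"
    using fc(1) gc(1) by (auto simp: diff_op_ring_simps End_ring_def K.a_comm fun_eq_iff)
  show "\<zero>\<^bsub>D\<^esub> \<oplus>\<^bsub>D\<^esub> f = f"
    using fc(1,5) by (auto simp: diff_op_ring_simps End_ring_def fun_eq_iff extensional_def)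
  fix h assume h: "h \<in> carrier D"
  show "f \<oplus>\<^bsub>D\<^esub> g \<oplus>\<^bsub>D\<^esub> h = f \<oplus>\<^bsub>D\<^esub> (g \<oplus>\<^bsub>D\<^esub> h)"
    using fc(1) gc(1) End_contD(1)[OF diff_op_End_cont[OF h]]
    by (auto simp: diff_op_ring_simps End_ring_def K.a_assoc fun_eq_iff)
qed

text \<open>Turns an identity between entries of a matrix product into an identity of sums in
  \<open>K\<close>, one argument at a time.\<close>

lemma finsum_diff_op_apply:
  assumes "finite S" "\<And>l. l \<in> S \<Longrightarrow> f l \<in> carrier D" "x \<in> carrier K"
  shows "(\<Oplus>\<^bsub>D\<^esub>l\<in>S. f l) x = (\<Oplus>l\<in>S. f l x)"
  using assms
proof (induction S rule: finite_induct)
  case empty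
  then show ?case by (simp add: diff_op_ring_simps End_ring_def)
next
  case (insert i S)
  have "f l x \<in> carrier K" if "l \<in> insert i S" for l
    using End_contD(1)[OF diff_op_End_cont[OF insert.prems(1)[OF that]]] insert.prems by blast
  moreover have "(\<Oplus>\<^bsub>D\<^esub>l\<in>insert i S. f l) = f i \<oplus>\<^bsub>D\<^esub> (\<Oplus>\<^bsub>D\<^esub>l\<in>S. f l)"
    using insert by (intro D.finsum_insert) auto
  ultimately show ?case
    using insert by (auto simp: diff_op_ring_simps End_ring_def K.finsum_insert Pi_iff)
qed

end

subsection \<open>Vector spaces\<close>

locale field_module = Module.module K V for K :: "('b, 'c) ring_scheme" (structure) and V :: "('b, 'm) module" +
  assumes field_K: "field K"
begin

lemma ex_inverse:
  assumes "x \<in> carrier K" "x \<noteq> \<zero>"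
  obtains y where "y \<in> carrier K" "y \<otimes> x = \<one>"
  using assms field.field_Units[OF field_K] unfolding Units_def by blast

lemma zero_neq_one: "\<zero> \<noteq> \<one>"
  using domain.one_not_zero[OF field.axioms(1)[OF field_K]] by metis

section \<open>Subspaces, linear functionals and their kernels\<close>

lemma submoduleD:
  assumes "submodule W K V"
  shows "W \<subseteq> carrier V" "\<zero>\<^bsub>V\<^esub> \<in> W" "\<And>v. v \<in> W \<Longrightarrow> \<ominus>\<^bsub>V\<^esub> v \<in> W"
    "\<And>v w. v \<in> W \<Longrightarrow> w \<in> W \<Longrightarrow> v \<oplus>\<^bsub>V\<^esub> w \<in> W"
    "\<And>v w. v \<in> W \<Longrightarrow> w \<in> W \<Longrightarrow> v \<ominus>\<^bsub>V\<^esub> w \<in> W"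
    "\<And>a v. a \<in> carrier K \<Longrightarrow> v \<in> W \<Longrightarrow> a \<odot>\<^bsub>V\<^esub> v \<in> W"
  using submoduleE[OF assms] subgroup.one_closed[OF submodule.axioms(1)[OF assms]]
  by (auto simp: a_minus_def)

text \<open>Linearity is asked on a set inside one fixed space and not on a module record, so that
  passing to a subspace or a kernel merely shrinks the set.\<close>

definition functional :: "'m set \<Rightarrow> ('m \<Rightarrow> 'b) \<Rightarrow> bool" where
  "functional W p \<longleftrightarrow> p \<in> W \<rightarrow> carrier K \<and> (\<forall>v\<in>W. \<forall>w\<in>W. p (v \<oplus>\<^bsub>V\<^esub> w) = p v \<oplus> p w) \<and>
     (\<forall>a\<in>carrier K. \<forall>v\<in>W. p (a \<odot>\<^bsub>V\<^esub> v) = a \<otimes> p v)"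

lemma functionalD:
  assumes "functional W p"
  shows "\<And>v. v \<in> W \<Longrightarrow> p v \<in> carrier K"
    "\<And>v w. v \<in> W \<Longrightarrow> w \<in> W \<Longrightarrow> p (v \<oplus>\<^bsub>V\<^esub> w) = p v \<oplus> p w"
    "\<And>a v. a \<in> carrier K \<Longrightarrow> v \<in> W \<Longrightarrow> p (a \<odot>\<^bsub>V\<^esub> v) = a \<otimes> p v"
  using assms by (auto simp: functional_def)

lemma functional_zero:
  assumes "functional W p" "submodule W K V"
  shows "p \<zero>\<^bsub>V\<^esub> = \<zero>"
  using functionalD(3)[OF assms(1) R.zero_closed, of "\<zero>\<^bsub>V\<^esub>"] functionalD(1)[OF assms(1), of "\<zero>\<^bsub>V\<^esub>"]
    submoduleD(2)[OF assms(2)] by simp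

lemma functional_diff:
  assumes p: "functional W p" and W: "submodule W K V" and v: "v \<in> W" and w: "w \<in> W"
  shows "p (v \<ominus>\<^bsub>V\<^esub> w) = p v \<ominus> p w"
proof -
  have wV: "w \<in> carrier V" using submoduleD(1)[OF W] w by blast
  have "\<ominus>\<^bsub>V\<^esub> w = (\<ominus> \<one>) \<odot>\<^bsub>V\<^esub> w" using wV by (simp add: smult_l_minus)
  then have "p (\<ominus>\<^bsub>V\<^esub> w) = \<ominus> p w"
    using functionalD(3)[OF p _ w, of "\<ominus> \<one>"] functionalD(1)[OF p w] by (simp add: R.l_minus)
  then show ?thesis
    using functionalD(2)[OF p v submoduleD(3)[OF W w]] by (simp add: a_minus_def)
qed

lemma functional_subset: "functional W p \<Longrightarrow> W' \<subseteq> W \<Longrightarrow> functional W' p"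
  by (auto simp: functional_def subset_iff)

lemma submodule_kernel:
  assumes p: "functional W p" and W: "submodule W K V"
  shows "submodule {v \<in> W. p v = \<zero>} K V"
proof (rule submoduleI)
  show "\<ominus>\<^bsub>V\<^esub> v \<in> {v \<in> W. p v = \<zero>}" if "v \<in> {v \<in> W. p v = \<zero>}" for v
  proof -
    have "p (\<zero>\<^bsub>V\<^esub> \<ominus>\<^bsub>V\<^esub> v) = \<zero>"
      using functional_diff[OF p W submoduleD(2)[OF W], of v] that functional_zero[OF p W]
      by (simp add: a_minus_def)
    then show ?thesis using that submoduleD(1,3)[OF W] by (auto simp: a_minus_def subset_iff)
  qed
qed (use submoduleD[OF W] functionalD[OF p] functional_zero[OF p W] in auto)

lemma smult_diff:
  assumes "a \<in> carrier K" "v \<in> carrier V" "w \<in> carrier V"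
  shows "a \<odot>\<^bsub>V\<^esub> (v \<ominus>\<^bsub>V\<^esub> w) = a \<odot>\<^bsub>V\<^esub> v \<ominus>\<^bsub>V\<^esub> a \<odot>\<^bsub>V\<^esub> w"
  using assms by (simp add: a_minus_def smult_r_distr smult_r_minus)

text \<open>The vectors \<open>b l\<close> are the images of a basis under a projection onto \<open>W\<close>.\<close>

lemma ex_adapted_family:
  fixes n :: nat
  assumes p: "\<And>l. l < n \<Longrightarrow> functional (carrier V) (p l)" and W: "submodule W K V"
    and sep: "\<And>v. v \<in> W \<Longrightarrow> (\<And>l. l < n \<Longrightarrow> p l v = \<zero>) \<Longrightarrow> v = \<zero>\<^bsub>V\<^esub>"
  shows "\<exists>b. (\<forall>l<n. b l \<in> W) \<and> (\<forall>v\<in>W. v = (\<Oplus>\<^bsub>V\<^esub>l\<in>{..<n}. p l v \<odot>\<^bsub>V\<^esub> b l))"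
  using p W sep
proof (induction n arbitrary: W)
  case 0
  then show ?case by auto
next
  case (Suc n)
  note WD = submoduleD[OF Suc.prems(2)]
  have pn: "functional W (p n)" by (rule functional_subset[OF Suc.prems(1) WD(1)]) simp
  define W' where "W' = {v \<in> W. p n v = \<zero>}"
  have "\<exists>b. (\<forall>l<n. b l \<in> W') \<and> (\<forall>v\<in>W'. v = (\<Oplus>\<^bsub>V\<^esub>l\<in>{..<n}. p l v \<odot>\<^bsub>V\<^esub> b l))"
  proof (rule Suc.IH)
    show "submodule W' K V" unfolding W'_def by (rule submodule_kernel[OF pn Suc.prems(2)])
    show "v = \<zero>\<^bsub>V\<^esub>" if "v \<in> W'" "\<And>l. l < n \<Longrightarrow> p l v = \<zero>" for v
      using that by (intro Suc.prems(3)) (auto simp: W'_def less_Suc_eq)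
  qed (use Suc.prems(1) in simp)
  then obtain b where bW': "\<And>l. l < n \<Longrightarrow> b l \<in> W'"
    and b: "\<And>v. v \<in> W' \<Longrightarrow> v = (\<Oplus>\<^bsub>V\<^esub>l\<in>{..<n}. p l v \<odot>\<^bsub>V\<^esub> b l)" by blast
  have bV: "b l \<in> carrier V" if "l < n" for l using bW'[OF that] WD(1) by (auto simp: W'_def)
  have pK: "p l v \<in> carrier K" if "l < Suc n" "v \<in> W" for l v
    using functionalD(1)[OF Suc.prems(1)] that WD(1) by blast
  have sum_Suc: "(\<Oplus>\<^bsub>V\<^esub>l\<in>{..<Suc n}. p l v \<odot>\<^bsub>V\<^esub> (b(n := u)) l)
      = p n v \<odot>\<^bsub>V\<^esub> u \<oplus>\<^bsub>V\<^esub> (\<Oplus>\<^bsub>V\<^esub>l\<in>{..<n}. p l v \<odot>\<^bsub>V\<^esub> b l)"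
    if "v \<in> W" "u \<in> W" for u v
  proof -
    have "(\<Oplus>\<^bsub>V\<^esub>l\<in>{..<n}. p l v \<odot>\<^bsub>V\<^esub> (b(n := u)) l) = (\<Oplus>\<^bsub>V\<^esub>l\<in>{..<n}. p l v \<odot>\<^bsub>V\<^esub> b l)"
      by (rule M.finsum_cong') (use pK that bV in auto)
    moreover have "(\<lambda>l. p l v \<odot>\<^bsub>V\<^esub> (b(n := u)) l) \<in> {..<n} \<rightarrow> carrier V"
      using pK that bV by auto
    moreover have "p n v \<odot>\<^bsub>V\<^esub> u \<in> carrier V" using pK[of n v] that WD(1) by auto
    ultimately show ?thesis by (simp add: lessThan_Suc M.finsum_insert)
  qed
  show ?case
  proof (cases "\<forall>v\<in>W. p n v = \<zero>")
    \<comment> \<open>A last functional that vanishes on \<open>W\<close> contributes nothing, and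
      the zero vector serves as its partner.\<close>
    case True
    then have "W' = W" by (auto simp: W'_def)
    then have "\<forall>v\<in>W. v = (\<Oplus>\<^bsub>V\<^esub>l\<in>{..<Suc n}. p l v \<odot>\<^bsub>V\<^esub> (b(n := \<zero>\<^bsub>V\<^esub>)) l)"
      using sum_Suc[OF _ WD(2)] True b bV pK WD(1)
      by (smt (verit, ccfv_SIG) M.l_zero R.zero_closed smult_r_null subset_iff)
    moreover have "\<forall>l<Suc n. (b(n := \<zero>\<^bsub>V\<^esub>)) l \<in> W" using bW' WD(2) by (auto simp: W'_def)
    ultimately show ?thesis by blast
  next
    case False
    then obtain w0 where w0: "w0 \<in> W" "p n w0 \<noteq> \<zero>" by blast
    obtain y where y: "y \<in> carrier K" "y \<otimes> p n w0 = \<one>"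
      using ex_inverse[OF functionalD(1)[OF pn w0(1)] w0(2)] .
    \<comment> \<open>Normalised so that \<open>p n w = \<one>\<close>: subtracting
      \<open>p n v\<close> times \<open>w\<close> from \<open>v\<close> then lands in the kernel
      \<open>W'\<close>.\<close>
    define w where "w = y \<odot>\<^bsub>V\<^esub> w0"
    have w: "w \<in> W" "p n w = \<one>"
      using y w0 functionalD(3)[OF pn y(1) w0(1)] WD(6) by (auto simp: w_def)
    have wV: "w \<in> carrier V" using w WD(1) by blast
    \<comment> \<open>The expansion given by the induction hypothesis, now evaluated on all of
      \<open>W\<close>; on \<open>W'\<close> it is the identity.\<close>
    define s where "s v = (\<Oplus>\<^bsub>V\<^esub>l\<in>{..<n}. p l v \<odot>\<^bsub>V\<^esub> b l)" for v
    have s_clos: "s v \<in> carrier V" if "v \<in> W" for v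
      unfolding s_def by (rule M.finsum_closed) (use pK that bV in auto)
    have s_W: "s v \<in> W" if "v \<in> W" for v
    proof -
      have "(\<Oplus>\<^bsub>V\<^esub>l\<in>S. p l v \<odot>\<^bsub>V\<^esub> b l) \<in> W" if "finite S" "S \<subseteq> {..<n}" for S
        using that
      proof (induction S rule: finite_induct)
        case (insert i S)
        have "(\<lambda>l. p l v \<odot>\<^bsub>V\<^esub> b l) \<in> insert i S \<rightarrow> carrier V"
          using insert.prems pK[OF _ \<open>v \<in> W\<close>] bV by auto
        moreover have "p i v \<odot>\<^bsub>V\<^esub> b i \<in> W"
          using insert.prems pK[OF _ \<open>v \<in> W\<close>] bW'[of i] WD(6) by (auto simp: W'_def)
        ultimately show ?case
          using insert WD(4) by (simp add: M.finsum_insert Pi_iff)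
      qed (simp add: WD(2))
      then show ?thesis unfolding s_def by blast
    qed
    have sum_split: "s u = s v \<ominus>\<^bsub>V\<^esub> c \<odot>\<^bsub>V\<^esub> s w"
      if v: "v \<in> W" and c: "c \<in> carrier K" and u: "u = v \<ominus>\<^bsub>V\<^esub> c \<odot>\<^bsub>V\<^esub> w" for u v c
    proof -
      have pu: "p l u = p l v \<ominus> c \<otimes> p l w" if "l < n" for l
      proof -
        have "functional W (p l)" by (rule functional_subset[OF Suc.prems(1) WD(1)]) (use that in simp)
        then show ?thesis
          using functional_diff[OF _ Suc.prems(2) v WD(6)[OF c w(1)]] functionalD(3)[OF _ c w(1)]
          by (simp add: u)
      qed
      have "s v \<ominus>\<^bsub>V\<^esub> c \<odot>\<^bsub>V\<^esub> s w =
          s v \<oplus>\<^bsub>V\<^esub> (\<Oplus>\<^bsub>V\<^esub>l\<in>{..<n}. (\<ominus> c) \<odot>\<^bsub>V\<^esub> (p l w \<odot>\<^bsub>V\<^esub> b l))"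
        using finsum_smult_ldistr[of "{..<n}" "\<ominus> c" "\<lambda>l. p l w \<odot>\<^bsub>V\<^esub> b l"] pK[OF _ w(1)] bV c s_clos[OF w(1)]
        by (simp add: s_def Pi_iff a_minus_def smult_l_minus)
      also have "\<dots> = (\<Oplus>\<^bsub>V\<^esub>l\<in>{..<n}. p l v \<odot>\<^bsub>V\<^esub> b l \<oplus>\<^bsub>V\<^esub> (\<ominus> c) \<odot>\<^bsub>V\<^esub> (p l w \<odot>\<^bsub>V\<^esub> b l))"
        unfolding s_def by (rule M.finsum_addf[symmetric]) (use pK v w(1) bV c in auto)
      also have "\<dots> = s u"
        unfolding s_def
      proof (rule M.finsum_cong')
        show "p l v \<odot>\<^bsub>V\<^esub> b l \<oplus>\<^bsub>V\<^esub> (\<ominus> c) \<odot>\<^bsub>V\<^esub> (p l w \<odot>\<^bsub>V\<^esub> b l) = p l u \<odot>\<^bsub>V\<^esub> b l"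
          if "l \<in> {..<n}" for l
          using that pK[OF _ v] pK[OF _ w(1)] c bV
          by (simp add: pu a_minus_def smult_l_distr smult_l_minus smult_assoc1)
      qed (use pK v w(1) c bV in \<open>auto simp: pu\<close>)
      finally show ?thesis by simp
    qed
    \<comment> \<open>As \<open>v - c w\<close> lies in \<open>W'\<close>, it is fixed by the linear
      map \<open>s\<close>, which gives \<open>v = s v + c (w - s w)\<close>. This dictates
      \<open>w - s w\<close> as the last vector.\<close>
    have "v = (\<Oplus>\<^bsub>V\<^esub>l\<in>{..<Suc n}. p l v \<odot>\<^bsub>V\<^esub> (b(n := w \<ominus>\<^bsub>V\<^esub> s w)) l)" if v: "v \<in> W" for v
    proof -
      define c where "c = p n v"
      have c: "c \<in> carrier K" using pK[OF _ v] by (simp add: c_def)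
      define u where "u = v \<ominus>\<^bsub>V\<^esub> c \<odot>\<^bsub>V\<^esub> w"
      have "u \<in> W" unfolding u_def by (intro WD(5) WD(6) v w c)
      moreover have "p n u = \<zero>"
        using functional_diff[OF pn Suc.prems(2) v WD(6)[OF c w(1)]] functionalD(3)[OF pn c w(1)] w(2) c
        by (simp add: u_def c_def a_minus_def R.r_neg)
      ultimately have "u = s u" using b by (simp add: W'_def s_def)
      then have eq: "v \<ominus>\<^bsub>V\<^esub> c \<odot>\<^bsub>V\<^esub> w = s v \<ominus>\<^bsub>V\<^esub> c \<odot>\<^bsub>V\<^esub> s w"
        using sum_split[OF v c u_def] by (simp add: u_def)
      have vV: "v \<in> carrier V" using v WD(1) by blast
      have "v = c \<odot>\<^bsub>V\<^esub> w \<oplus>\<^bsub>V\<^esub> (v \<ominus>\<^bsub>V\<^esub> c \<odot>\<^bsub>V\<^esub> w)"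
        using vV wV c by (simp add: a_minus_def M.a_lcomm M.r_neg)
      also have "\<dots> = c \<odot>\<^bsub>V\<^esub> (w \<ominus>\<^bsub>V\<^esub> s w) \<oplus>\<^bsub>V\<^esub> s v"
        unfolding eq using wV c s_clos[OF v] s_clos[OF w(1)]
        by (simp add: a_minus_def smult_r_distr smult_r_minus M.a_ac)
      finally show ?thesis
        using sum_Suc[OF v WD(5)[OF w(1) s_W[OF w(1)]]] by (simp add: c_def s_def)
    qed
    moreover have "\<forall>l<Suc n. (b(n := w \<ominus>\<^bsub>V\<^esub> s w)) l \<in> W"
      using bW' WD(5)[OF w(1) s_W[OF w(1)]] by (auto simp: W'_def less_Suc_eq)
    ultimately show ?thesis by blast
  qed
qed

definition separated :: "nat \<Rightarrow> 'm set \<Rightarrow> bool" where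
  "separated r W \<longleftrightarrow> (\<exists>(I :: nat set) p. finite I \<and> card I \<le> r \<and> (\<forall>i\<in>I. functional W (p i)) \<and>
     (\<forall>v\<in>W. (\<forall>i\<in>I. p i v = \<zero>) \<longrightarrow> v = \<zero>\<^bsub>V\<^esub>))"

text \<open>A nonzero functional cuts the dimension by one. Some \<open>p j\<close> does not vanish
  at \<open>w\<close>; the others, composed with the projection \<open>e\<close> along
  \<open>w\<close> onto the kernel of \<open>p j\<close>, separate the kernel of \<open>q\<close>,
  because a multiple of \<open>w\<close> on which \<open>q\<close> vanishes is zero.\<close>

lemma separated_kernel:
  assumes sep: "separated r W" and W: "submodule W K V" and q: "functional W q"
    and w: "w \<in> W" "q w \<noteq> \<zero>"
  obtains r' where "r = Suc r'" "separated r' {v \<in> W. q v = \<zero>}"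
proof -
  note WD = submoduleD[OF W]
  obtain I p where I: "finite (I :: nat set)" "card I \<le> r" and p': "\<forall>i\<in>I. functional W (p i)"
    and zero': "\<forall>v\<in>W. (\<forall>i\<in>I. p i v = \<zero>) \<longrightarrow> v = \<zero>\<^bsub>V\<^esub>"
    using sep unfolding separated_def by (elim exE conjE)
  note p = p'[rule_format] and zero = zero'[rule_format]
  have "w \<noteq> \<zero>\<^bsub>V\<^esub>" using functional_zero[OF q W] w(2) by auto
  then obtain j where j: "j \<in> I" "p j w \<noteq> \<zero>" using zero[OF w(1)] by blast
  obtain y where y: "y \<in> carrier K" "y \<otimes> p j w = \<one>"
    using ex_inverse[OF functionalD(1)[OF p[OF j(1)] w(1)] j(2)] .
  let ?W' = "{v \<in> W. q v = \<zero>}"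
  define e where "e v = v \<ominus>\<^bsub>V\<^esub> (p j v \<otimes> y) \<odot>\<^bsub>V\<^esub> w" for v
  note pjK = functionalD(1)[OF p[OF j(1)]]
  have eW: "e v \<in> W" if "v \<in> W" for v
    unfolding e_def using that y(1) pjK by (intro WD(5) WD(6) w(1)) auto
  have pe: "p i (e v) = p i v \<ominus> (p j v \<otimes> y) \<otimes> p i w" if "i \<in> I" "v \<in> W" for i v
    using functional_diff[OF p[OF that(1)] W that(2), of "(p j v \<otimes> y) \<odot>\<^bsub>V\<^esub> w"]
      functionalD(3)[OF p[OF that(1)] _ w(1), of "p j v \<otimes> y"] WD(6) w(1) y(1) pjK[OF that(2)]
    by (simp add: e_def)
  define p' where "p' i v = p i (e v)" for i v
  have e_add: "e (u \<oplus>\<^bsub>V\<^esub> v) = e u \<oplus>\<^bsub>V\<^esub> e v" if "u \<in> W" "v \<in> W" for u v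
  proof -
    have "u \<in> carrier V" "v \<in> carrier V" "w \<in> carrier V" using that w WD(1) by auto
    then show ?thesis
      using that y(1) pjK[OF that(1)] pjK[OF that(2)]
      by (simp add: e_def functionalD(2)[OF p[OF j(1)]] R.l_distr smult_l_distr a_minus_def
          M.minus_add M.a_ac)
  qed
  have e_smult: "e (a \<odot>\<^bsub>V\<^esub> v) = a \<odot>\<^bsub>V\<^esub> e v" if "a \<in> carrier K" "v \<in> W" for a v
  proof -
    have "v \<in> carrier V" "w \<in> carrier V" using that w WD(1) by auto
    then show ?thesis
      using that y(1) pjK[OF that(2)]
      by (simp add: e_def functionalD(3)[OF p[OF j(1)]] smult_diff smult_assoc1 R.m_assoc)
  qed
  have "functional ?W' (p' i)" if "i \<in> I - {j}" for i
  proof -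
    have i: "i \<in> I" using that by blast
    show ?thesis
      unfolding functional_def p'_def using functionalD[OF p[OF i]] eW by (auto simp: e_add e_smult)
  qed
  moreover have "v = \<zero>\<^bsub>V\<^esub>" if v: "v \<in> ?W'" "\<forall>i\<in>I - {j}. p' i v = \<zero>" for v
  proof -
    have vW: "v \<in> W" "q v = \<zero>" using v by auto
    have "p j (e v) = \<zero>"
      using pe[OF j(1) vW(1)] y pjK[OF vW(1)] pjK[OF w(1)] by (simp add: R.m_assoc a_minus_def R.r_neg)
    then have "e v = \<zero>\<^bsub>V\<^esub>" using v(2) by (intro zero[OF eW[OF vW(1)]]) (auto simp: p'_def)
    moreover have V: "v \<in> carrier V" "(p j v \<otimes> y) \<odot>\<^bsub>V\<^esub> w \<in> carrier V"
      using vW(1) w(1) y(1) pjK[OF vW(1)] WD(1) by auto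
    ultimately have ve: "v = (p j v \<otimes> y) \<odot>\<^bsub>V\<^esub> w"
      using M.add.inv_solve_right'[of "\<zero>\<^bsub>V\<^esub>" v "(p j v \<otimes> y) \<odot>\<^bsub>V\<^esub> w"]
      by (simp add: e_def a_minus_def)
    have "(p j v \<otimes> y) \<otimes> q w = q ((p j v \<otimes> y) \<odot>\<^bsub>V\<^esub> w)"
      using functionalD(3)[OF q _ w(1), of "p j v \<otimes> y"] y(1) pjK[OF vW(1)] by simp
    also have "\<dots> = \<zero>" using vW(2) ve by simp
    finally have "p j v \<otimes> y = \<zero>"
      using domain.integral[OF field.axioms(1)[OF field_K]] w(2) functionalD(1)[OF q w(1)]
        y(1) pjK[OF vW(1)] R.m_closed by blast
    then have "v = \<zero> \<odot>\<^bsub>V\<^esub> w" using ve by simp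
    then show ?thesis using w(1) WD(1) by auto
  qed
  moreover have "card I \<noteq> 0" "card (I - {j}) = card I - 1"
    using I(1) j(1) by (auto simp: card_Diff_singleton)
  ultimately have "separated (r - 1) ?W'"
    unfolding separated_def using I by (intro exI[of _ "I - {j}"] exI[of _ p']) auto
  moreover have "r = Suc (r - 1)" using \<open>card I \<noteq> 0\<close> I(2) by simp
  ultimately show thesis using that by blast
qed

text \<open>The functionals on the kernel of \<open>q\<close> are extended to \<open>W\<close> by
  the projection \<open>e\<close> along \<open>w\<close>, and \<open>q\<close> itself joins them
  under a fresh index \<open>j\<close>.\<close>

lemma separated_extend:
  assumes W: "submodule W K V" and q: "functional W q" and w: "w \<in> W" "q w \<noteq> \<zero>"
    and sep: "separated r {v \<in> W. q v = \<zero>}"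
  shows "separated (Suc r) W"
proof -
  note WD = submoduleD[OF W]
  obtain I p where I: "finite (I :: nat set)" "card I \<le> r"
    and p': "\<forall>i\<in>I. functional {v \<in> W. q v = \<zero>} (p i)"
    and zero': "\<forall>v\<in>{v \<in> W. q v = \<zero>}. (\<forall>i\<in>I. p i v = \<zero>) \<longrightarrow> v = \<zero>\<^bsub>V\<^esub>"
    using sep unfolding separated_def by (elim exE conjE)
  note p = p'[rule_format] and zero = zero'[rule_format]
  obtain y where y: "y \<in> carrier K" "y \<otimes> q w = \<one>"
    using ex_inverse[OF functionalD(1)[OF q w(1)] w(2)] .
  note qK = functionalD(1)[OF q]
  define e where "e v = v \<ominus>\<^bsub>V\<^esub> (q v \<otimes> y) \<odot>\<^bsub>V\<^esub> w" for v
  have eW: "e v \<in> {v \<in> W. q v = \<zero>}" if "v \<in> W" for v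
  proof -
    have "e v \<in> W" unfolding e_def using that y(1) qK by (intro WD(5) WD(6) w(1)) auto
    moreover have "q (e v) = q v \<ominus> (q v \<otimes> y) \<otimes> q w"
      using functional_diff[OF q W that, of "(q v \<otimes> y) \<odot>\<^bsub>V\<^esub> w"]
        functionalD(3)[OF q _ w(1), of "q v \<otimes> y"] WD(6) w(1) y(1) qK[OF that]
      by (simp add: e_def)
    ultimately show ?thesis
      using y qK[OF that] qK[OF w(1)] by (simp add: R.m_assoc a_minus_def R.r_neg)
  qed
  have e_add: "e (u \<oplus>\<^bsub>V\<^esub> v) = e u \<oplus>\<^bsub>V\<^esub> e v" if "u \<in> W" "v \<in> W" for u v
  proof -
    have "u \<in> carrier V" "v \<in> carrier V" "w \<in> carrier V" using that w WD(1) by auto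
    then show ?thesis
      using that y(1) qK[OF that(1)] qK[OF that(2)]
      by (simp add: e_def functionalD(2)[OF q] R.l_distr smult_l_distr a_minus_def M.minus_add M.a_ac)
  qed
  have e_smult: "e (a \<odot>\<^bsub>V\<^esub> v) = a \<odot>\<^bsub>V\<^esub> e v" if "a \<in> carrier K" "v \<in> W" for a v
  proof -
    have "v \<in> carrier V" "w \<in> carrier V" using that w WD(1) by auto
    then show ?thesis
      using that y(1) qK[OF that(2)]
      by (simp add: e_def functionalD(3)[OF q] smult_diff smult_assoc1 R.m_assoc)
  qed
  obtain j where j: "j \<notin> I" using I(1) ex_new_if_finite infinite_UNIV_nat by blast
  define p' where "p' i = (if i = j then q else p i \<circ> e)" for i
  have "functional W (p' i)" if "i \<in> insert j I" for i
  proof (cases "i = j")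
    case False
    then have "functional {v \<in> W. q v = \<zero>} (p i)" using that p by blast
    from functionalD[OF this] show ?thesis
      using False eW by (auto simp: functional_def p'_def e_add e_smult)
  qed (simp add: p'_def q)
  moreover have "v = \<zero>\<^bsub>V\<^esub>" if v: "v \<in> W" "\<forall>i\<in>insert j I. p' i v = \<zero>" for v
  proof -
    have "q v = \<zero>" using v(2) by (simp add: p'_def)
    moreover have "e v = v"
      using calculation v(1) w(1) WD(1) y(1) by (auto simp: e_def subset_iff a_minus_def)
    moreover have "p i v = \<zero>" if "i \<in> I" for i
      using v(2) that j \<open>e v = v\<close> by (fastforce simp: p'_def split: if_splits)
    ultimately show ?thesis using zero[of v] v(1) by blast
  qed
  ultimately show ?thesis
    unfolding separated_def using I j
    by (intro exI[of _ "insert j I"] exI[of _ p']) auto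
qed

text \<open>Vectors with dual functionals bound the dimension from below. By duality the kernel of
  the last functional still contains the other vectors, and \<open>separated_kernel\<close> lowers
  \<open>r\<close> along with \<open>n\<close>.\<close>

lemma separated_ge_dim:
  fixes n :: nat
  assumes "submodule W K V" "separated r W"
    and "\<And>i. i < n \<Longrightarrow> functional W (c i)" "\<And>i. i < n \<Longrightarrow> e i \<in> W"
    and "\<And>i j. i < n \<Longrightarrow> j < n \<Longrightarrow> c i (e j) = (if i = j then \<one> else \<zero>)"
  shows "n \<le> r"
  using assms
proof (induction n arbitrary: r W)
  case (Suc n)
  have cn: "functional W (c n)" using Suc.prems(3) by simp
  obtain r' where r': "r = Suc r'" "separated r' {v \<in> W. c n v = \<zero>}"
    using separated_kernel[OF Suc.prems(2,1) cn, of "e n"] Suc.prems(4,5) zero_neq_one by auto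
  have "n \<le> r'"
  proof (rule Suc.IH[OF submodule_kernel[OF cn Suc.prems(1)] r'(2)])
    show "functional {v \<in> W. c n v = \<zero>} (c i)" if "i < n" for i
      using functional_subset[OF Suc.prems(3)] that by auto
  qed (use Suc.prems(4,5) in auto)
  then show ?case using r'(1) by simp
qed simp


lemma functional_finsum:
  assumes p: "functional (carrier V) p" and "finite S" "\<And>i. i \<in> S \<Longrightarrow> f i \<in> carrier V"
  shows "p (\<Oplus>\<^bsub>V\<^esub>i\<in>S. f i) = (\<Oplus>i\<in>S. p (f i))"
  using assms(2,3)
proof (induction S rule: finite_induct)
  case empty
  then show ?case using functional_zero[OF p carrier_is_submodule] by simp
next
  case (insert i S)
  then show ?case
    using functionalD(1,2)[OF p] by (simp add: M.finsum_insert R.finsum_insert Pi_iff)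
qed

section \<open>Coordinates given by an isomorphism from a column space\<close>

context
  fixes r :: nat and \<psi>
  assumes iso: "\<psi> \<in> linear_isos K (col_module K r) V"
begin

definition basis_vec :: "nat \<Rightarrow> 'm" where
  "basis_vec j = \<psi> (\<lambda>l\<in>{..<r}. if l = j then \<one> else \<zero>)"

definition coord :: "nat \<Rightarrow> 'm \<Rightarrow> 'b" where
  "coord i v = inv_into (carrier (col_module K r)) \<psi> v i"

lemma col_carrier: "carrier (col_module K r) = {..<r} \<rightarrow>\<^sub>E carrier K"
  by (simp add: col_module_def)

lemma psi_closed: "y \<in> carrier (col_module K r) \<Longrightarrow> \<psi> y \<in> carrier V"
  using iso by (auto simp: linear_isos_def linear_maps_def)

lemma psi_add:
  assumes "y \<in> carrier (col_module K r)" "z \<in> carrier (col_module K r)"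
  shows "\<psi> (\<lambda>i\<in>{..<r}. y i \<oplus> z i) = \<psi> y \<oplus>\<^bsub>V\<^esub> \<psi> z"
proof -
  have "\<psi> (y \<oplus>\<^bsub>col_module K r\<^esub> z) = \<psi> y \<oplus>\<^bsub>V\<^esub> \<psi> z"
    using iso assms unfolding linear_isos_def linear_maps_def by blast
  then show ?thesis by (simp add: col_module_def)
qed

lemma psi_smult:
  assumes "a \<in> carrier K" "y \<in> carrier (col_module K r)"
  shows "\<psi> (\<lambda>i\<in>{..<r}. a \<otimes> y i) = a \<odot>\<^bsub>V\<^esub> \<psi> y"
proof -
  have "\<psi> (a \<odot>\<^bsub>col_module K r\<^esub> y) = a \<odot>\<^bsub>V\<^esub> \<psi> y"
    using iso assms unfolding linear_isos_def linear_maps_def by blast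
  then show ?thesis by (simp add: col_module_def)
qed

lemma psi_inv:
  assumes "v \<in> carrier V"
  shows "inv_into (carrier (col_module K r)) \<psi> v \<in> carrier (col_module K r)"
    "\<psi> (inv_into (carrier (col_module K r)) \<psi> v) = v"
  using iso assms unfolding linear_isos_def
  by (auto simp: bij_betw_def inv_into_into f_inv_into_f)

lemma inv_psi:
  "y \<in> carrier (col_module K r) \<Longrightarrow> inv_into (carrier (col_module K r)) \<psi> (\<psi> y) = y"
  using iso unfolding linear_isos_def by (auto simp: bij_betw_def inv_into_f_f)

lemma basis_vec_closed: "basis_vec j \<in> carrier V"
  unfolding basis_vec_def by (rule psi_closed) (auto simp: col_carrier)

text \<open>Identifies the images of the columns that \<open>hom_matrix\<close> inserts.\<close>

lemma psi_single:
  assumes "x \<in> carrier K"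
  shows "\<psi> (\<lambda>l\<in>{..<r}. if l = j then x else \<zero>) = x \<odot>\<^bsub>V\<^esub> basis_vec j"
proof -
  have y: "(\<lambda>l\<in>{..<r}. if l = j then \<one> else \<zero>) \<in> carrier (col_module K r)"
    by (auto simp: col_carrier)
  have "(\<lambda>l\<in>{..<r}. if l = j then x else \<zero>)
      = (\<lambda>i\<in>{..<r}. x \<otimes> (\<lambda>l\<in>{..<r}. if l = j then \<one> else \<zero>) i)"
    using assms by (auto simp: fun_eq_iff)
  then have "\<psi> (\<lambda>l\<in>{..<r}. if l = j then x else \<zero>)
      = \<psi> (\<lambda>i\<in>{..<r}. x \<otimes> (\<lambda>l\<in>{..<r}. if l = j then \<one> else \<zero>) i)" by (rule arg_cong)
  also have "\<dots> = x \<odot>\<^bsub>V\<^esub> basis_vec j"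
    unfolding basis_vec_def by (rule psi_smult[OF assms y])
  finally show ?thesis .
qed

lemma coord_basis_vec:
  assumes "i < r"
  shows "coord i (basis_vec j) = (if i = j then \<one> else \<zero>)"
  unfolding coord_def basis_vec_def
  using assms by (subst inv_psi) (auto simp: col_carrier)

lemma functional_coord:
  assumes i: "i < r"
  shows "functional (carrier V) (coord i)"
  unfolding functional_def coord_def
proof (intro conjI ballI)
  let ?c = "inv_into (carrier (col_module K r)) \<psi>"
  show "(\<lambda>v. ?c v i) \<in> carrier V \<rightarrow> carrier K"
    using psi_inv(1) i by (auto simp: col_carrier)
  fix v assume v: "v \<in> carrier V"
  note cv = psi_inv[OF v]
  show "?c (v \<oplus>\<^bsub>V\<^esub> w) i = ?c v i \<oplus> ?c w i" if w: "w \<in> carrier V" for w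
  proof -
    note cw = psi_inv[OF w]
    have "\<psi> (\<lambda>i\<in>{..<r}. ?c v i \<oplus> ?c w i) = v \<oplus>\<^bsub>V\<^esub> w"
      using psi_add[OF cv(1) cw(1)] cv(2) cw(2) by simp
    moreover have "(\<lambda>i\<in>{..<r}. ?c v i \<oplus> ?c w i) \<in> carrier (col_module K r)"
      using cv(1) cw(1) by (auto simp: col_carrier)
    ultimately have "?c (v \<oplus>\<^bsub>V\<^esub> w) = (\<lambda>i\<in>{..<r}. ?c v i \<oplus> ?c w i)" using inv_psi by metis
    then show ?thesis using i by simp
  qed
  show "?c (a \<odot>\<^bsub>V\<^esub> v) i = a \<otimes> ?c v i" if a: "a \<in> carrier K" for a
  proof -
    have "\<psi> (\<lambda>i\<in>{..<r}. a \<otimes> ?c v i) = a \<odot>\<^bsub>V\<^esub> v"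
      using psi_smult[OF a cv(1)] cv(2) by simp
    moreover have "(\<lambda>i\<in>{..<r}. a \<otimes> ?c v i) \<in> carrier (col_module K r)"
      using cv(1) a by (auto simp: col_carrier)
    ultimately have "?c (a \<odot>\<^bsub>V\<^esub> v) = (\<lambda>i\<in>{..<r}. a \<otimes> ?c v i)" using inv_psi by metis
    then show ?thesis using i by simp
  qed
qed

lemma psi_expand:
  assumes y: "y \<in> carrier (col_module K r)"
  shows "\<psi> y = (\<Oplus>\<^bsub>V\<^esub>l\<in>{..<r}. y l \<odot>\<^bsub>V\<^esub> basis_vec l)"
proof -
  have yK: "y l \<in> carrier K" if "l < r" for l using y that by (auto simp: col_carrier)
  \<comment> \<open>Truncation to the first \<open>n\<close> entries, running from the zero column
    to \<open>y\<close> itself at \<open>n = r\<close>, where extensionality of columns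
    enters.\<close>
  let ?t = "\<lambda>n. \<lambda>l\<in>{..<r}. if l < n then y l else \<zero>"
  have t: "?t n \<in> carrier (col_module K r)" for n using yK by (auto simp: col_carrier)
  have t_r: "?t r = y"
    by (rule ext) (use y in \<open>auto simp: col_carrier PiE_def extensional_def\<close>)
  have "\<psi> (?t n) = (\<Oplus>\<^bsub>V\<^esub>l\<in>{..<n}. y l \<odot>\<^bsub>V\<^esub> basis_vec l)" if "n \<le> r" for n
    using that
  proof (induction n)
    case 0
    have "?t 0 = (\<lambda>i\<in>{..<r}. \<zero> \<otimes> ?t 0 i)" by (auto simp: fun_eq_iff)
    then have "\<psi> (?t 0) = \<psi> (\<lambda>i\<in>{..<r}. \<zero> \<otimes> ?t 0 i)" by (rule arg_cong)
    also have "\<dots> = \<zero>\<^bsub>V\<^esub>"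
      unfolding psi_smult[OF R.zero_closed t[of 0]] by (rule smult_l_null[OF psi_closed[OF t]])
    finally show ?case unfolding lessThan_0 M.finsum_empty .
  next
    case (Suc n)
    then have n: "n < r" by simp
    let ?u = "\<lambda>l\<in>{..<r}. if l = n then y n else \<zero>"
    have u: "?u \<in> carrier (col_module K r)" using yK[OF n] by (auto simp: col_carrier)
    have "?t (Suc n) = (\<lambda>i\<in>{..<r}. ?u i \<oplus> ?t n i)"
    proof (rule restrict_ext)
      show "(if l < Suc n then y l else \<zero>) = ?u l \<oplus> ?t n l" if "l \<in> {..<r}" for l
        using yK[of l] that by (cases l n rule: linorder_cases) auto
    qed
    then have "\<psi> (?t (Suc n)) = \<psi> (\<lambda>i\<in>{..<r}. ?u i \<oplus> ?t n i)" by (rule arg_cong)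
    also have "\<dots> = \<psi> ?u \<oplus>\<^bsub>V\<^esub> \<psi> (?t n)" by (rule psi_add[OF u t])
    also have "\<dots> = y n \<odot>\<^bsub>V\<^esub> basis_vec n \<oplus>\<^bsub>V\<^esub> (\<Oplus>\<^bsub>V\<^esub>l\<in>{..<n}. y l \<odot>\<^bsub>V\<^esub> basis_vec l)"
      unfolding psi_single[OF yK[OF n]] Suc.IH[OF less_imp_le[OF n]] ..
    also have "\<dots> = (\<Oplus>\<^bsub>V\<^esub>l\<in>{..<Suc n}. y l \<odot>\<^bsub>V\<^esub> basis_vec l)"
      unfolding lessThan_Suc
      by (rule M.finsum_insert[symmetric]) (use yK n basis_vec_closed in auto)
    finally show ?case .
  qed
  from this[OF order_refl] show ?thesis
    unfolding t_r .
qed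

lemma coord_expand:
  assumes "v \<in> carrier V"
  shows "v = (\<Oplus>\<^bsub>V\<^esub>l\<in>{..<r}. coord l v \<odot>\<^bsub>V\<^esub> basis_vec l)"
  using psi_expand[OF psi_inv(1)[OF assms]] psi_inv(2)[OF assms] by (simp add: coord_def)

lemma coord_separating:
  assumes v: "v \<in> carrier V" and zero: "\<And>l. l < r \<Longrightarrow> coord l v = \<zero>"
  shows "v = \<zero>\<^bsub>V\<^esub>"
proof -
  have "(\<Oplus>\<^bsub>V\<^esub>l\<in>{..<r}. coord l v \<odot>\<^bsub>V\<^esub> basis_vec l) = (\<Oplus>\<^bsub>V\<^esub>l\<in>{..<r}. \<zero>\<^bsub>V\<^esub>)"
    by (rule M.finsum_cong') (use zero basis_vec_closed in auto)
  then show ?thesis using coord_expand[OF v] by simp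
qed

lemma separated_carrier: "separated r (carrier V)"
  unfolding separated_def
  by (intro exI[of _ "{..<r}"] exI[of _ coord]) (auto intro: functional_coord coord_separating)

text \<open>Together with \<open>separated_carrier\<close> this makes \<open>r\<close> the least
  admissible bound, through which the ranks of the two isomorphisms are compared.\<close>

lemma separated_carrier_ge: "separated n (carrier V) \<Longrightarrow> r \<le> n"
  by (rule separated_ge_dim[OF carrier_is_submodule, of n r coord basis_vec])
    (auto simp: functional_coord basis_vec_closed coord_basis_vec)

end

end

subsection \<open>Modules over a nilpotent extension of a field\<close>

lemma finsum_rest: "finsum (rest f M) g S = finsum M g S"
  by (simp add: finsum_def finprod_def rest_def)

text \<open>The residue map is abstracted to a homomorphism \<open>pr\<close> to a field with
  nilpotent kernel. Only \<open>K\<close> is topologised here; a topology on \<open>A\<close> enters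
  as a separate assumption where preciseness is used.\<close>

locale nilpotent_extension = st_algebra k K TK
  for k :: "'k ring" and K :: "('k, 'b) module" (structure) and TK :: "'b topology" +
  fixes A :: "('k, 'a) module" and M :: "('a, 'm) module" and pr :: "'a \<Rightarrow> 'b" and N :: nat
  assumes kA: "algebra k A" and field_K: "field K" and pr: "pr \<in> algebra_homs k A K"
    and M: "Module.module A M"
    and nilpotent: "ideal_pow A (a_kernel A K pr) N = {\<zero>\<^bsub>A\<^esub>}"
begin

sublocale A: cring A using kA by (rule algebra.M_cring)
sublocale M: Module.module A M by (rule M)

text \<open>A section of \<open>pr\<close>, that is, a lifting stripped of continuity. Each section
  makes \<open>M\<close> a \<open>K\<close>-space on the same carrier, whence the abbreviations
  indexed by \<open>s\<close>.\<close>

definition retraction :: "('b \<Rightarrow> 'a) \<Rightarrow> bool" where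
  "retraction s \<longleftrightarrow> s \<in> algebra_homs k K A \<and> (\<forall>x\<in>carrier K. pr (s x) = x)"

abbreviation "I \<equiv> a_kernel A K pr"
abbreviation "P \<equiv> ideal_pow A I"

abbreviation "functional s \<equiv> field_module.functional K (rest s M)"
abbreviation "separated s \<equiv> field_module.separated K (rest s M)"

section \<open>The kernel ideal, its powers, and sections of the projection\<close>

lemma pr_hom: "pr \<in> ring_hom A K" using pr by (simp add: algebra_homs_def)

lemma I_ideal: "ideal I A"
  by (rule ring_hom_ring.kernel_is_ideal)
    (rule ring_hom_ringI2[OF A.ring_axioms K.ring_axioms pr_hom])

lemma I_iff: "c \<in> I \<longleftrightarrow> c \<in> carrier A \<and> pr c = \<zero>"
  by (auto simp: a_kernel_def')

lemma P_carrier: "y \<in> P j \<Longrightarrow> y \<in> carrier A"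
  using ideal.Icarr[OF A.ideal_pow_ideal[OF I_ideal]] .

lemma P_mult: "y \<in> P j \<Longrightarrow> c \<in> I \<Longrightarrow> y \<otimes>\<^bsub>A\<^esub> c \<in> P (Suc j)"
  using ideal_prod.prod[of c I y "P j" A] P_carrier[of y j] by (simp add: I_iff A.m_comm)

lemma retractionD:
  assumes "retraction s"
  shows "\<And>x. x \<in> carrier K \<Longrightarrow> s x \<in> carrier A" "\<And>x. x \<in> carrier K \<Longrightarrow> pr (s x) = x"
    "\<And>x y. x \<in> carrier K \<Longrightarrow> y \<in> carrier K \<Longrightarrow> s (x \<oplus> y) = s x \<oplus>\<^bsub>A\<^esub> s y"
    "\<And>x y. x \<in> carrier K \<Longrightarrow> y \<in> carrier K \<Longrightarrow> s (x \<otimes> y) = s x \<otimes>\<^bsub>A\<^esub> s y"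
    "s \<one> = \<one>\<^bsub>A\<^esub>" "s \<in> ring_hom K A"
    "\<And>c x. c \<in> carrier k \<Longrightarrow> x \<in> carrier K \<Longrightarrow> s (c \<odot>\<^bsub>K\<^esub> x) = c \<odot>\<^bsub>A\<^esub> s x"
  using assms unfolding retraction_def algebra_homs_def ring_hom_def by auto

lemma field_module_rest:
  assumes "retraction s"
  shows "field_module K (rest s M)"
  using module_rest_ring_hom[OF K.is_cring A.is_cring retractionD(6)[OF assms] M] field_K
  by (simp add: field_module_def field_module_axioms_def)

lemma submodule_rest:
  assumes s: "retraction s" and N: "submodule W A M"
  shows "submodule W K (rest s M)"
proof -
  interpret S: field_module K "rest s M" by (rule field_module_rest[OF s])
  show ?thesis
    using M.submoduleE[OF N] subgroup.one_closed[OF submodule.axioms(1)[OF N]] retractionD(1)[OF s]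
    by (intro S.submoduleI) auto
qed

text \<open>Both values lift \<open>x\<close>, so \<open>pr\<close> sends their difference to
  \<open>x \<ominus> x\<close>. This is what makes iterated commutators of the entries
  vanish.\<close>

lemma retraction_diff:
  assumes "retraction s" "retraction t" "x \<in> carrier K"
  shows "t x \<ominus>\<^bsub>A\<^esub> s x \<in> I"
proof -
  interpret pr: ring_hom_ring A K pr by (rule ring_hom_ringI2[OF A.ring_axioms K.ring_axioms pr_hom])
  show ?thesis
    using retractionD(1,2)[OF assms(1)] retractionD(1,2)[OF assms(2)] assms(3)
    by (simp add: I_iff a_minus_def K.r_neg)
qed

text \<open>The submodule killed by the \<open>j\<close>-th power of the kernel. It is zero at
  \<open>j = 0\<close> and all of \<open>M\<close> at \<open>j = N\<close>, and multiplication by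
  \<open>I\<close> lowers the index by one.\<close>

definition ann :: "nat \<Rightarrow> 'm set" where
  "ann j = {n \<in> carrier M. \<forall>y\<in>P j. y \<odot>\<^bsub>M\<^esub> n = \<zero>\<^bsub>M\<^esub>}"

lemma ann_0: "n \<in> ann 0 \<Longrightarrow> n = \<zero>\<^bsub>M\<^esub>"
  using M.smult_one[of n] by (auto simp: ann_def)

lemma ann_N: "ann N = carrier M"
  by (auto simp: ann_def nilpotent)

lemma ann_carrier: "n \<in> ann j \<Longrightarrow> n \<in> carrier M"
  by (simp add: ann_def)

lemma ann_Suc: "n \<in> ann (Suc j) \<Longrightarrow> c \<in> I \<Longrightarrow> c \<odot>\<^bsub>M\<^esub> n \<in> ann j"
  using P_mult P_carrier by (auto simp: ann_def I_iff simp flip: M.smult_assoc1 simp del: ideal_pow.simps)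

lemma submodule_ann: "submodule (ann j) A M"
proof (rule M.submoduleI)
  fix a n assume a: "a \<in> carrier A" and n: "n \<in> ann j"
  have "y \<odot>\<^bsub>M\<^esub> (a \<odot>\<^bsub>M\<^esub> n) = \<zero>\<^bsub>M\<^esub>" if y: "y \<in> P j" for y
  proof -
    have "y \<odot>\<^bsub>M\<^esub> (a \<odot>\<^bsub>M\<^esub> n) = a \<odot>\<^bsub>M\<^esub> (y \<odot>\<^bsub>M\<^esub> n)"
      using a P_carrier[OF y] ann_carrier[OF n] by (simp flip: M.smult_assoc1 add: A.m_comm)
    then show ?thesis using a n y by (simp add: ann_def)
  qed
  then show "a \<odot>\<^bsub>M\<^esub> n \<in> ann j" using a n by (simp add: ann_def)
qed (auto simp: ann_def M.smult_r_distr M.smult_r_minus P_carrier)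

section \<open>Comparison of dimensions for two sections\<close>

lemma pr_decomp:
  assumes "retraction s" "a \<in> carrier A"
  shows "pr a \<in> carrier K" "a \<ominus>\<^bsub>A\<^esub> s (pr a) \<in> I" "a = s (pr a) \<oplus>\<^bsub>A\<^esub> (a \<ominus>\<^bsub>A\<^esub> s (pr a))"
proof -
  interpret pr: ring_hom_ring A K pr by (rule ring_hom_ringI2[OF A.ring_axioms K.ring_axioms pr_hom])
  show a: "pr a \<in> carrier K" using assms(2) by simp
  note sa = retractionD(1,2)[OF assms(1) a]
  show "a \<ominus>\<^bsub>A\<^esub> s (pr a) \<in> I" using sa assms(2) by (simp add: I_iff a_minus_def K.r_neg)
  show "a = s (pr a) \<oplus>\<^bsub>A\<^esub> (a \<ominus>\<^bsub>A\<^esub> s (pr a))"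
    using sa assms(2) by (simp add: a_minus_def A.a_lcomm A.r_neg)
qed

text \<open>For some \<open>j\<close> the functional \<open>q\<close> vanishes on the multiples of
  \<open>W\<close> by \<open>P (Suc j)\<close> but not on those by \<open>P j\<close>.
  Precomposition with a suitable \<open>y\<close> in \<open>P j\<close> keeps it nonzero, and the
  result kills multiples by \<open>I\<close> because \<open>y\<close> times \<open>I\<close> lies in
  \<open>P (Suc j)\<close>.\<close>

lemma functional_kills_multiples:
  assumes s: "retraction s" and W: "submodule W A M" and q: "functional s W q"
    and w: "w \<in> W" "q w \<noteq> \<zero>"
  obtains q' w' where "functional s W q'" "w' \<in> W" "q' w' \<noteq> \<zero>"
    "\<And>c v. c \<in> I \<Longrightarrow> v \<in> W \<Longrightarrow> q' (c \<odot>\<^bsub>M\<^esub> v) = \<zero>"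
proof -
  interpret S: field_module K "rest s M" by (rule field_module_rest[OF s])
  note WM = M.submoduleE[OF W]
  note qD = S.functionalD[OF q, simplified]
  \<comment> \<open>\<open>Q\<close> fails at 0, where \<open>y = \<one>\<close> is allowed, and
    holds at \<open>N\<close>, where only \<open>y = 0\<close> is left; so it switches at some index
    in between.\<close>
  define Q where "Q j \<longleftrightarrow> (\<forall>y\<in>P j. \<forall>v\<in>W. q (y \<odot>\<^bsub>M\<^esub> v) = \<zero>)" for j
  have "Q N"
    using S.functional_zero[OF q submodule_rest[OF s W]] WM(1) by (auto simp: Q_def nilpotent subset_iff)
  moreover have "\<not> Q 0"
    using w WM(1) by (auto simp: Q_def subset_iff intro!: bexI[of _ "\<one>\<^bsub>A\<^esub>"] bexI[of _ w])
  ultimately obtain j where j: "\<not> Q j" "Q (Suc j)"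
    using dec_induct[of 0 N "\<lambda>j. \<not> Q j"] by blast
  then obtain y w' where y: "y \<in> P j" and w': "w' \<in> W" "q (y \<odot>\<^bsub>M\<^esub> w') \<noteq> \<zero>"
    unfolding Q_def by blast
  note yA = P_carrier[OF y]
  have yW: "y \<odot>\<^bsub>M\<^esub> v \<in> W" if "v \<in> W" for v using WM(4)[OF yA that] .
  have "functional s W (\<lambda>v. q (y \<odot>\<^bsub>M\<^esub> v))"
    unfolding S.functional_def
  proof (intro conjI ballI)
    show "(\<lambda>v. q (y \<odot>\<^bsub>M\<^esub> v)) \<in> W \<rightarrow> carrier K" using yW qD(1) by auto
    fix v assume v: "v \<in> W"
    have vM: "v \<in> carrier M" using v WM(1) by blast
    show "q (y \<odot>\<^bsub>M\<^esub> (v \<oplus>\<^bsub>rest s M\<^esub> w)) = q (y \<odot>\<^bsub>M\<^esub> v) \<oplus> q (y \<odot>\<^bsub>M\<^esub> w)" if w: "w \<in> W" for w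
    proof -
      have "w \<in> carrier M" using w WM(1) by blast
      then show ?thesis using qD(2)[OF yW[OF v] yW[OF w]] vM yA by (simp add: M.smult_r_distr)
    qed
    show "q (y \<odot>\<^bsub>M\<^esub> (a \<odot>\<^bsub>rest s M\<^esub> v)) = a \<otimes> q (y \<odot>\<^bsub>M\<^esub> v)" if a: "a \<in> carrier K" for a
    proof -
      have "y \<odot>\<^bsub>M\<^esub> (s a \<odot>\<^bsub>M\<^esub> v) = s a \<odot>\<^bsub>M\<^esub> (y \<odot>\<^bsub>M\<^esub> v)"
        using retractionD(1)[OF s a] yA vM by (simp flip: M.smult_assoc1 add: A.m_comm)
      then show ?thesis using qD(3)[OF a yW[OF v]] by simp
    qed
  qed
  moreover have "q (y \<odot>\<^bsub>M\<^esub> (c \<odot>\<^bsub>M\<^esub> v)) = \<zero>" if "c \<in> I" "v \<in> W" for c v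
  proof -
    have "v \<in> carrier M" "c \<in> carrier A" using that WM(1) by (auto simp: I_iff)
    then have "y \<odot>\<^bsub>M\<^esub> (c \<odot>\<^bsub>M\<^esub> v) = (y \<otimes>\<^bsub>A\<^esub> c) \<odot>\<^bsub>M\<^esub> v" using yA by (simp add: M.smult_assoc1)
    then show ?thesis using j(2) P_mult[OF y that(1)] that(2) unfolding Q_def by metis
  qed
  ultimately show thesis using that w' by blast
qed

text \<open>Strong induction on \<open>r\<close>. A functional that kills the multiples by
  \<open>I\<close> is linear for both sections, and its kernel is an \<open>A\<close>-submodule with
  a smaller bound for \<open>s\<close>. The bound passes to \<open>t\<close> there, and
  \<open>separated_extend\<close> returns to \<open>W\<close>.\<close>

lemma separated_transfer:
  assumes s: "retraction s" and t: "retraction t"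
    and W: "submodule W A M" and sep: "separated s r W"
  shows "separated t r W"
proof -
  interpret S: field_module K "rest s M" by (rule field_module_rest[OF s])
  interpret T: field_module K "rest t M" by (rule field_module_rest[OF t])
  show ?thesis
    using W sep
  proof (induction r arbitrary: W rule: less_induct)
    case (less r)
    note WM = M.submoduleE[OF less.prems(1)]
    note SW = submodule_rest[OF s less.prems(1)] and TW = submodule_rest[OF t less.prems(1)]
    show ?case
    proof (cases "\<exists>q w. functional s W q \<and> w \<in> W \<and> q w \<noteq> \<zero>")
      \<comment> \<open>The separating family for \<open>s\<close> then consists of zero maps, so
        \<open>W\<close> is zero and the empty family separates it for \<open>t\<close>.\<close>
      case False
      then have "v = \<zero>\<^bsub>M\<^esub>" if "v \<in> W" for v
        using less.prems(2) that unfolding S.separated_def rest_simps by blast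
      then show ?thesis
        unfolding T.separated_def rest_simps by (intro exI[of _ "{}"]) auto
    next
      case True
      then obtain q w where "functional s W q" "w \<in> W" "q w \<noteq> \<zero>" by blast
      then obtain q w where q: "functional s W q" and w: "w \<in> W" "q w \<noteq> \<zero>"
        and kill: "\<And>c v. c \<in> I \<Longrightarrow> v \<in> W \<Longrightarrow> q (c \<odot>\<^bsub>M\<^esub> v) = \<zero>"
        by (rule functional_kills_multiples[OF s less.prems(1)]) blast
      note qD = S.functionalD[OF q, simplified]
      \<comment> \<open>Here \<open>a\<close> is \<open>s (pr a)\<close> plus an element of
        \<open>I\<close>, whose multiples \<open>q\<close> ignores. The scalar thus acts through
        \<open>pr\<close> alone, independently of the section.\<close>
      have q_smult: "q (a \<odot>\<^bsub>M\<^esub> v) = pr a \<otimes> q v" if a: "a \<in> carrier A" and v: "v \<in> W" for a v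
      proof -
        note d = pr_decomp[OF s a]
        have vM: "v \<in> carrier M" using v WM(1) by blast
        have c: "a \<ominus>\<^bsub>A\<^esub> s (pr a) \<in> carrier A" using d(2) by (simp add: I_iff)
        have "a \<odot>\<^bsub>M\<^esub> v = s (pr a) \<odot>\<^bsub>M\<^esub> v \<oplus>\<^bsub>M\<^esub> (a \<ominus>\<^bsub>A\<^esub> s (pr a)) \<odot>\<^bsub>M\<^esub> v"
          by (subst d(3)) (rule M.smult_l_distr[OF retractionD(1)[OF s d(1)] c vM])
        then have "q (a \<odot>\<^bsub>M\<^esub> v) = pr a \<otimes> q v \<oplus> q ((a \<ominus>\<^bsub>A\<^esub> s (pr a)) \<odot>\<^bsub>M\<^esub> v)"
          using qD(2)[OF WM(4)[OF retractionD(1)[OF s d(1)] v] WM(4)[OF c v]] qD(3)[OF d(1) v] by simp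
        then show ?thesis using kill[OF d(2) v] d(1) qD(1)[OF v] by simp
      qed
      have qT: "functional t W q"
        unfolding T.functional_def using qD(1,2) q_smult retractionD(1,2)[OF t] by simp
      obtain r' where r': "r = Suc r'" "separated s r' {v \<in> W. q v = \<zero>}"
        by (rule S.separated_kernel[OF less.prems(2) SW q w])
      have "submodule {v \<in> W. q v = \<zero>} A M"
      proof (rule M.submoduleI)
        fix a v assume "a \<in> carrier A" "v \<in> {v \<in> W. q v = \<zero>}"
        then show "a \<odot>\<^bsub>M\<^esub> v \<in> {v \<in> W. q v = \<zero>}"
          using q_smult[of a v] WM(4) pr_decomp(1)[OF s] by simp
      qed (use S.submoduleD[OF S.submodule_kernel[OF q SW]] WM(1) in auto)
      then have "separated t r' {v \<in> W. q v = \<zero>}" using less.IH[of r'] r' by simp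
      then show ?thesis using T.separated_extend[OF TW qT w] r'(1) by simp
    qed
  qed
qed

section \<open>Matrix entries as differential operators\<close>

context
  fixes s t p
  assumes s: "retraction s" and t: "retraction t" and p: "functional t (carrier M) p"
    and cont: "\<And>n. n \<in> carrier M \<Longrightarrow> continuous_map TK TK (\<lambda>x. p (s x \<odot>\<^bsub>M\<^esub> n))"
begin

interpretation T: field_module K "rest t M" by (rule field_module_rest[OF t])

text \<open>The argument enters through \<open>s\<close> while \<open>p\<close> is linear along
  \<open>t\<close>. Both sections agree on scalars coming from \<open>k\<close>, which gives
  linearity over \<open>k\<close>.\<close>

lemma entry_End_cont:
  assumes n: "n \<in> carrier M"
  shows "(\<lambda>x\<in>carrier K. p (s x \<odot>\<^bsub>M\<^esub> n)) \<in> End_cont k K TK"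
proof (rule End_contI)
  note pD = T.functionalD[OF p, simplified] and sD = retractionD[OF s]
  show "p (s x \<odot>\<^bsub>M\<^esub> n) \<in> carrier K" if "x \<in> carrier K" for x
    using that n sD(1) pD(1) by simp
  show "p (s (x \<oplus> y) \<odot>\<^bsub>M\<^esub> n) = p (s x \<odot>\<^bsub>M\<^esub> n) \<oplus> p (s y \<odot>\<^bsub>M\<^esub> n)"
    if "x \<in> carrier K" "y \<in> carrier K" for x y
    using that n sD(1)[OF that(1)] sD(1)[OF that(2)] by (simp add: sD(3) M.smult_l_distr pD(2))
  show "p (s (c \<odot>\<^bsub>K\<^esub> x) \<odot>\<^bsub>M\<^esub> n) = c \<odot>\<^bsub>K\<^esub> p (s x \<odot>\<^bsub>M\<^esub> n)"
    if c: "c \<in> carrier k" and x: "x \<in> carrier K" for c x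
  proof -
    interpret kA: Module.module k A by (rule algebra.axioms(1)[OF kA])
    have sx: "s x \<in> carrier A" by (rule sD(1)[OF x])
    have cK: "c \<odot>\<^bsub>K\<^esub> \<one> \<in> carrier K" using c by simp
    \<comment> \<open>The scalar is rewritten as a value of \<open>t\<close>, the form in which
      \<open>p\<close> can release it.\<close>
    have "s (c \<odot>\<^bsub>K\<^esub> x) = t (c \<odot>\<^bsub>K\<^esub> \<one>) \<otimes>\<^bsub>A\<^esub> s x"
      using sD(7)[OF c x] retractionD(7)[OF t c K.one_closed] retractionD(5)[OF t]
        algebra.smult_assoc2[OF kA c A.one_closed sx] sx by simp
    then have "p (s (c \<odot>\<^bsub>K\<^esub> x) \<odot>\<^bsub>M\<^esub> n) = (c \<odot>\<^bsub>K\<^esub> \<one>) \<otimes> p (s x \<odot>\<^bsub>M\<^esub> n)"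
      using pD(3)[OF cK, of "s x \<odot>\<^bsub>M\<^esub> n"] sx n retractionD(1)[OF t cK] by (simp add: M.smult_assoc1)
    also have "\<dots> = c \<odot>\<^bsub>K\<^esub> p (s x \<odot>\<^bsub>M\<^esub> n)"
      using algebra.smult_assoc2[OF alg c K.one_closed] pD(1) sx n by simp
    finally show ?thesis .
  qed
qed (rule cont[OF n])

text \<open>The commutator with \<open>a\<close> replaces \<open>n\<close> by its multiple by
  \<open>t a - s a\<close>, one step lower in \<open>ann\<close>. At \<open>j = 0\<close> this
  multiple is zero, matching the zero term of index -1.\<close>

lemma entry_filt:
  "n \<in> ann (Suc j) \<Longrightarrow> (\<lambda>x\<in>carrier K. p (s x \<odot>\<^bsub>M\<^esub> n)) \<in> F j"
proof (induction j arbitrary: n)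
  note pD = T.functionalD[OF p, simplified] and sD = retractionD[OF s] and tD = retractionD[OF t]
  \<comment> \<open>With \<open>m\<close> equal to \<open>s x\<close> times \<open>n\<close>, the
    factor \<open>a\<close> becomes \<open>t a\<close> by linearity of \<open>p\<close> and
    \<open>s a\<close> by multiplicativity of \<open>s\<close>; the commutator is \<open>p\<close>
    of the difference.\<close>
  have comm: "mult_commutator K a (\<lambda>x\<in>carrier K. p (s x \<odot>\<^bsub>M\<^esub> n))
      = (\<lambda>x\<in>carrier K. p (s x \<odot>\<^bsub>M\<^esub> ((t a \<ominus>\<^bsub>A\<^esub> s a) \<odot>\<^bsub>M\<^esub> n)))"
    if a: "a \<in> carrier K" and n: "n \<in> carrier M" for a n
    unfolding mult_commutator_def
  proof (rule restrict_ext)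
    fix x assume x: "x \<in> carrier K"
    have ta: "t a \<in> carrier A" and sa: "s a \<in> carrier A" and sx: "s x \<in> carrier A"
      using tD(1) sD(1) a x by auto
    define m where "m = s x \<odot>\<^bsub>M\<^esub> n"
    have m: "m \<in> carrier M" using sx n by (simp add: m_def)
    have "s x \<odot>\<^bsub>M\<^esub> ((t a \<ominus>\<^bsub>A\<^esub> s a) \<odot>\<^bsub>M\<^esub> n) = t a \<odot>\<^bsub>M\<^esub> m \<ominus>\<^bsub>M\<^esub> s a \<odot>\<^bsub>M\<^esub> m"
    proof -
      have "s x \<odot>\<^bsub>M\<^esub> ((t a \<ominus>\<^bsub>A\<^esub> s a) \<odot>\<^bsub>M\<^esub> n) = (t a \<ominus>\<^bsub>A\<^esub> s a) \<odot>\<^bsub>M\<^esub> m"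
        unfolding m_def using ta sa sx n by (simp flip: M.smult_assoc1 add: A.m_comm)
      then show ?thesis using ta sa m by (simp add: a_minus_def M.smult_l_distr M.smult_l_minus)
    qed
    moreover have "p (t a \<odot>\<^bsub>M\<^esub> m \<ominus>\<^bsub>M\<^esub> s a \<odot>\<^bsub>M\<^esub> m) = p (t a \<odot>\<^bsub>M\<^esub> m) \<ominus> p (s a \<odot>\<^bsub>M\<^esub> m)"
      using T.functional_diff[OF p T.carrier_is_submodule[simplified], of "t a \<odot>\<^bsub>M\<^esub> m" "s a \<odot>\<^bsub>M\<^esub> m"]
        ta sa m by (simp add: a_minus_def)
    moreover have "p (t a \<odot>\<^bsub>M\<^esub> m) = a \<otimes> p m" using pD(3)[OF a m] .
    moreover have "s (a \<otimes> x) \<odot>\<^bsub>M\<^esub> n = s a \<odot>\<^bsub>M\<^esub> m"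
      using sD(4)[OF a x] sa sx n by (simp add: m_def M.smult_assoc1)
    ultimately show "a \<otimes> (\<lambda>x\<in>carrier K. p (s x \<odot>\<^bsub>M\<^esub> n)) x \<ominus> (\<lambda>x\<in>carrier K. p (s x \<odot>\<^bsub>M\<^esub> n)) (a \<otimes> x)
        = p (s x \<odot>\<^bsub>M\<^esub> ((t a \<ominus>\<^bsub>A\<^esub> s a) \<odot>\<^bsub>M\<^esub> n))"
      using a x by (simp add: m_def)
  qed
  {
    case 0
    have "mult_commutator K a (\<lambda>x\<in>carrier K. p (s x \<odot>\<^bsub>M\<^esub> n)) = \<zero>\<^bsub>E\<^esub>" if a: "a \<in> carrier K" for a
    proof -
      have "(t a \<ominus>\<^bsub>A\<^esub> s a) \<odot>\<^bsub>M\<^esub> n = \<zero>\<^bsub>M\<^esub>"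
        using ann_0[OF ann_Suc[OF 0 retraction_diff[OF s t a]]] .
      moreover have "p (s x \<odot>\<^bsub>M\<^esub> \<zero>\<^bsub>M\<^esub>) = \<zero>" if "x \<in> carrier K" for x
        using sD(1)[OF that] T.functional_zero[OF p T.carrier_is_submodule[simplified]] by simp
      ultimately show ?thesis
        using comm[OF a ann_carrier[OF 0]] by (simp add: End_ring_def cong: restrict_cong)
    qed
    then show ?case
      unfolding diff_op_filt.simps using entry_End_cont[OF ann_carrier[OF 0]] by blast
  next
    case (Suc j)
    have "mult_commutator K a (\<lambda>x\<in>carrier K. p (s x \<odot>\<^bsub>M\<^esub> n)) \<in> F j" if a: "a \<in> carrier K" for a
      unfolding comm[OF a ann_carrier[OF Suc.prems]]
      by (rule Suc.IH[OF ann_Suc[OF Suc.prems retraction_diff[OF s t a]]])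
    then show ?case
      unfolding diff_op_filt.simps using entry_End_cont[OF ann_carrier[OF Suc.prems]] by blast
  }
qed

lemma entry_diff_op:
  assumes n: "n \<in> carrier M"
  shows "(\<lambda>x\<in>carrier K. p (s x \<odot>\<^bsub>M\<^esub> n)) \<in> carrier D"
proof -
  \<comment> \<open>One exponent beyond \<open>N\<close> gives the index the shape
    \<open>Suc j\<close> of \<open>entry_filt\<close>; powers of \<open>I\<close> decrease, so
    \<open>n\<close> is still killed.\<close>
  have "n \<in> ann (Suc N)"
  proof -
    have "P (Suc N) \<subseteq> P N"
      using A.ideal_prod_inter[OF I_ideal A.ideal_pow_ideal[OF I_ideal, of N]] by simp
    then have "y \<odot>\<^bsub>M\<^esub> n = \<zero>\<^bsub>M\<^esub>" if "y \<in> P (Suc N)" for y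
      using that n nilpotent by auto
    then show ?thesis using n unfolding ann_def by blast
  qed
  then show ?thesis unfolding diff_op_ring_simps using entry_filt by blast
qed

end

text \<open>Induction on the power of \<open>I\<close> that kills \<open>n\<close>. The vectors
  \<open>t x\<close> times \<open>n\<close> and \<open>s x\<close> times \<open>n\<close> differ by
  \<open>u x\<close>, one level lower, and \<open>q (u x)\<close> is a sum of entries of that level
  composed with the continuous coordinates of \<open>u x\<close>.\<close>

lemma continuous_inverse_entry:
  fixes r :: nat
  assumes s: "retraction s" and t: "retraction t" and q: "functional s (carrier M) q"
    and cont: "\<And>p n. functional t (carrier M) p \<Longrightarrow> n \<in> carrier M \<Longrightarrow>
      continuous_map TK TK (\<lambda>x. p (s x \<odot>\<^bsub>M\<^esub> n))"
    and c: "\<And>l. l < r \<Longrightarrow> functional t (carrier M) (c l)"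
    and sep: "\<And>v. v \<in> carrier M \<Longrightarrow> (\<And>l. l < r \<Longrightarrow> c l v = \<zero>) \<Longrightarrow> v = \<zero>\<^bsub>M\<^esub>"
    and n: "n \<in> carrier M"
  shows "continuous_map TK TK (\<lambda>x. q (t x \<odot>\<^bsub>M\<^esub> n))"
proof -
  interpret S: field_module K "rest s M" by (rule field_module_rest[OF s])
  interpret T: field_module K "rest t M" by (rule field_module_rest[OF t])
  note qD = S.functionalD[OF q, simplified] and sD = retractionD[OF s] and tD = retractionD[OF t]
  have "continuous_map TK TK (\<lambda>x. q (t x \<odot>\<^bsub>M\<^esub> n))" if "n \<in> ann j" for n j
    using that
  proof (induction j arbitrary: n)
    case 0
    have "q (t x \<odot>\<^bsub>M\<^esub> n) = \<zero>" if "x \<in> carrier K" for x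
      using ann_0[OF 0] S.functional_zero[OF q S.carrier_is_submodule[simplified]] tD(1)[OF that] by simp
    then show ?case
      by (intro continuous_map_eq[OF continuous_zero]) (simp add: topspace_TK)
  next
    case (Suc j)
    note nM = ann_carrier[OF Suc.prems]
    \<comment> \<open>Basis vectors of \<open>M\<close> may lie outside \<open>ann j\<close>. The
      adapted family expands elements of \<open>ann j\<close> with the same coordinates but with
      vectors inside \<open>ann j\<close>, to which the induction hypothesis applies.\<close>
    obtain b where b: "\<And>l. l < r \<Longrightarrow> b l \<in> ann j"
      and b_sum: "\<And>v. v \<in> ann j \<Longrightarrow> v = (\<Oplus>\<^bsub>rest t M\<^esub>l\<in>{..<r}. c l v \<odot>\<^bsub>rest t M\<^esub> b l)"
    proof -
      have "\<exists>b. (\<forall>l<r. b l \<in> ann j) \<and> (\<forall>v\<in>ann j. v = (\<Oplus>\<^bsub>rest t M\<^esub>l\<in>{..<r}. c l v \<odot>\<^bsub>rest t M\<^esub> b l))"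
        by (rule T.ex_adapted_family[OF _ submodule_rest[OF t submodule_ann]])
          (use c sep ann_carrier in auto)
      then show thesis using that by blast
    qed
    define u where "u x = (t x \<ominus>\<^bsub>A\<^esub> s x) \<odot>\<^bsub>M\<^esub> n" for x
    have u: "u x \<in> ann j" if "x \<in> carrier K" for x
      unfolding u_def by (rule ann_Suc[OF Suc.prems retraction_diff[OF s t that]])
    have tx: "t x \<odot>\<^bsub>M\<^esub> n = s x \<odot>\<^bsub>M\<^esub> n \<oplus>\<^bsub>M\<^esub> u x" if "x \<in> carrier K" for x
      using sD(1)[OF that] tD(1)[OF that] nM
        M.M.a_lcomm[of "s x \<odot>\<^bsub>M\<^esub> n" "t x \<odot>\<^bsub>M\<^esub> n" "\<ominus>\<^bsub>M\<^esub> (s x \<odot>\<^bsub>M\<^esub> n)"]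
      by (simp add: u_def a_minus_def M.smult_l_distr M.smult_l_minus M.M.r_neg)
    have g_cont: "continuous_map TK TK (\<lambda>x. c l (u x))" if l: "l < r" for l
    proof -
      note cD = T.functionalD[OF c[OF l], simplified]
      \<comment> \<open>Linearity of \<open>c l\<close> along \<open>t\<close> turns the part
        \<open>t x\<close> times \<open>n\<close> into multiplication by \<open>c l n\<close>; the
        part along \<open>s\<close> is continuous by \<open>cont\<close>.\<close>
      have "continuous_map TK TK (\<lambda>x. x \<otimes> c l n \<oplus> c l (s x \<odot>\<^bsub>M\<^esub> (\<ominus>\<^bsub>M\<^esub> n)))"
        by (intro continuous_add continuous_mult cont c l cD(1) nM M.M.a_inv_closed)
      then show ?thesis
      proof (rule continuous_map_eq)
        fix x assume "x \<in> topspace TK"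
        then have x: "x \<in> carrier K" by (simp add: topspace_TK)
        have "u x = t x \<odot>\<^bsub>M\<^esub> n \<oplus>\<^bsub>M\<^esub> s x \<odot>\<^bsub>M\<^esub> (\<ominus>\<^bsub>M\<^esub> n)"
          using sD(1)[OF x] tD(1)[OF x] nM
          by (simp add: u_def a_minus_def M.smult_l_distr M.smult_l_minus M.smult_r_minus)
        then show "x \<otimes> c l n \<oplus> c l (s x \<odot>\<^bsub>M\<^esub> (\<ominus>\<^bsub>M\<^esub> n)) = c l (u x)"
          using cD(2)[of "t x \<odot>\<^bsub>M\<^esub> n" "s x \<odot>\<^bsub>M\<^esub> (\<ominus>\<^bsub>M\<^esub> n)"] cD(3)[OF x nM] sD(1)[OF x] tD(1)[OF x] nM
          by simp
      qed
    qed
    \<comment> \<open>The first term comes from linearity of \<open>q\<close> along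
      \<open>s\<close>; each summand is the entry for \<open>b l\<close> evaluated at
      \<open>c l (u x)\<close>.\<close>
    have "continuous_map TK TK (\<lambda>x. x \<otimes> q n \<oplus> (\<Oplus>l\<in>{..<r}. q (t (c l (u x)) \<odot>\<^bsub>M\<^esub> b l)))"
    proof (intro continuous_add continuous_mult continuous_finsum qD(1) nM finite_lessThan)
      fix l assume "l \<in> {..<r}"
      then have l: "l < r" by simp
      show "continuous_map TK TK (\<lambda>x. q (t (c l (u x)) \<odot>\<^bsub>M\<^esub> b l))"
        using continuous_map_compose[OF g_cont[OF l] Suc.IH[OF b[OF l]]] by (simp add: o_def)
    qed
    then show ?case
    proof (rule continuous_map_eq)
      fix x assume "x \<in> topspace TK"
      then have x: "x \<in> carrier K" by (simp add: topspace_TK)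
      note ux = u[OF x]
      have cK: "c l (u x) \<in> carrier K" if "l < r" for l
        using T.functionalD(1)[OF c[OF that]] ann_carrier[OF ux] by simp
      have bM: "b l \<in> carrier M" if "l < r" for l using ann_carrier[OF b[OF that]] .
      have "u x = (\<Oplus>\<^bsub>rest s M\<^esub>l\<in>{..<r}. t (c l (u x)) \<odot>\<^bsub>M\<^esub> b l)"
        using b_sum[OF ux] by (simp add: finsum_rest)
      then have "q (u x) = (\<Oplus>l\<in>{..<r}. q (t (c l (u x)) \<odot>\<^bsub>M\<^esub> b l))"
        using S.functional_finsum[of q "{..<r}" "\<lambda>l. t (c l (u x)) \<odot>\<^bsub>M\<^esub> b l"] q cK bM tD(1) by simp
      moreover have "q (t x \<odot>\<^bsub>M\<^esub> n) = x \<otimes> q n \<oplus> q (u x)"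
        using tx[OF x] qD(2)[of "s x \<odot>\<^bsub>M\<^esub> n" "u x"] qD(3)[OF x nM] sD(1)[OF x] nM ann_carrier[OF ux]
        by simp
      ultimately show "x \<otimes> q n \<oplus> (\<Oplus>l\<in>{..<r}. q (t (c l (u x)) \<odot>\<^bsub>M\<^esub> b l)) = q (t x \<odot>\<^bsub>M\<^esub> n)"
        by simp
    qed
  qed
  from this[of n N] show ?thesis using n ann_N by simp
qed

text \<open>Continuity of the linear map \<open>a \<mapsto> p (a \<odot> n)\<close> is where preciseness of \<open>\<sigma>\<close> enters.\<close>

lemma continuous_entry_precise:
  assumes TA: "topspace TA = carrier A"
    and fine: "is_fine_topology k K TK (rest \<sigma> (self_module A)) TA"
    and \<sigma>: "retraction \<sigma>" and \<tau>: "retraction \<tau>" "continuous_map TK TA \<tau>"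
    and p: "functional \<sigma> (carrier M) p" and n: "n \<in> carrier M"
  shows "continuous_map TK TK (\<lambda>x. p (\<tau> x \<odot>\<^bsub>M\<^esub> n))"
proof -
  interpret S: field_module K "rest \<sigma> M" by (rule field_module_rest[OF \<sigma>])
  note pD = S.functionalD[OF p, simplified]
  have "(\<lambda>a. p (a \<odot>\<^bsub>M\<^esub> n)) \<in> linear_maps K (rest \<sigma> (self_module A)) (self_module K)"
    unfolding linear_maps_def
  proof (intro CollectI conjI ballI)
    show "(\<lambda>a. p (a \<odot>\<^bsub>M\<^esub> n)) \<in> carrier (rest \<sigma> (self_module A)) \<rightarrow> carrier (self_module K)"
      using pD(1) n by auto
    fix a assume "a \<in> carrier (rest \<sigma> (self_module A))"
    then have a: "a \<in> carrier A" by simp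
    show "p ((a \<oplus>\<^bsub>rest \<sigma> (self_module A)\<^esub> b) \<odot>\<^bsub>M\<^esub> n) = p (a \<odot>\<^bsub>M\<^esub> n) \<oplus>\<^bsub>self_module K\<^esub> p (b \<odot>\<^bsub>M\<^esub> n)"
      if "b \<in> carrier (rest \<sigma> (self_module A))" for b
      using a that n by (simp add: M.smult_l_distr pD(2))
    show "p ((x \<odot>\<^bsub>rest \<sigma> (self_module A)\<^esub> a) \<odot>\<^bsub>M\<^esub> n) = x \<odot>\<^bsub>self_module K\<^esub> p (a \<odot>\<^bsub>M\<^esub> n)"
      if x: "x \<in> carrier K" for x
      using pD(3)[OF x, of "a \<odot>\<^bsub>M\<^esub> n"] retractionD(1)[OF \<sigma> x] a n by (simp add: M.smult_assoc1)
  qed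
  \<comment> \<open>The base ring of this instance is \<open>K\<close>; \<open>A\<close> is the
    module that carries the fine topology over it.\<close>
  from linear_map_continuous_fine[OF alg fine topspace_TK st this]
  have "continuous_map TA TK (\<lambda>a. p (a \<odot>\<^bsub>M\<^esub> n))" .
  from continuous_map_compose[OF \<tau>(2) this] show ?thesis by (simp add: o_def)
qed

text \<open>The sum over \<open>l\<close> reassembles \<open>v\<close>, which is \<open>t x\<close>
  times \<open>f j\<close>, from its coordinates along \<open>s\<close>; so the entry at
  \<open>x\<close> is \<open>d i v\<close>, that is, \<open>x\<close> times
  \<open>d i (f j)\<close>. Exchanging the two families yields the product in the other
  order.\<close>

lemma transition_matrices_inverse:
  fixes r :: nat
  assumes s: "retraction s" and t: "retraction t"
    and e: "\<And>l. l < r \<Longrightarrow> e l \<in> carrier M" and c: "\<And>l. l < r \<Longrightarrow> functional s (carrier M) (c l)"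
    and expand: "\<And>v. v \<in> carrier M \<Longrightarrow> v = (\<Oplus>\<^bsub>M\<^esub>l\<in>{..<r}. s (c l v) \<odot>\<^bsub>M\<^esub> e l)"
    and f: "\<And>l. l < r \<Longrightarrow> f l \<in> carrier M" and d: "\<And>l. l < r \<Longrightarrow> functional t (carrier M) (d l)"
    and dual: "\<And>i j. i < r \<Longrightarrow> j < r \<Longrightarrow> d i (f j) = (if i = j then \<one> else \<zero>)"
    and G: "\<And>i j. i < r \<Longrightarrow> j < r \<Longrightarrow> G (i, j) = (\<lambda>x\<in>carrier K. d i (s x \<odot>\<^bsub>M\<^esub> e j))"
    and H: "\<And>i j. i < r \<Longrightarrow> j < r \<Longrightarrow> H (i, j) = (\<lambda>x\<in>carrier K. c i (t x \<odot>\<^bsub>M\<^esub> f j))"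
    and GD: "\<And>i j. i < r \<Longrightarrow> j < r \<Longrightarrow> G (i, j) \<in> carrier D"
    and HD: "\<And>i j. i < r \<Longrightarrow> j < r \<Longrightarrow> H (i, j) \<in> carrier D"
  shows "G \<otimes>\<^bsub>matrix_ring r D\<^esub> H = \<one>\<^bsub>matrix_ring r D\<^esub>"
proof -
  interpret S: field_module K "rest s M" by (rule field_module_rest[OF s])
  interpret T: field_module K "rest t M" by (rule field_module_rest[OF t])
  note sD = retractionD[OF s] and tD = retractionD[OF t]
  have "(\<Oplus>\<^bsub>D\<^esub>l\<in>{..<r}. G (i, l) \<otimes>\<^bsub>D\<^esub> H (l, j)) = (if i = j then \<one>\<^bsub>D\<^esub> else \<zero>\<^bsub>D\<^esub>)" (is "?L = ?R")
    if i: "i < r" and j: "j < r" for i j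
  proof
    fix x
    have LD: "G (i, l) \<otimes>\<^bsub>D\<^esub> H (l, j) \<in> carrier D" if "l \<in> {..<r}" for l
      using that by (intro diff_op_mult GD HD i j) auto
    note dD = T.functionalD[OF d[OF i], simplified]
    show "?L x = ?R x"
    proof (cases "x \<in> carrier K")
      case True
      define v where "v = t x \<odot>\<^bsub>M\<^esub> f j"
      have v: "v \<in> carrier M" using tD(1)[OF True] f[OF j] by (simp add: v_def)
      have cK: "c l v \<in> carrier K" if "l < r" for l using S.functionalD(1)[OF c[OF that]] v by simp
      have "?L x = (\<Oplus>l\<in>{..<r}. (G (i, l) \<otimes>\<^bsub>D\<^esub> H (l, j)) x)"
        by (rule finsum_diff_op_apply[OF _ LD True]) auto
      also have "\<dots> = (\<Oplus>l\<in>{..<r}. d i (s (c l v) \<odot>\<^bsub>M\<^esub> e l))"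
      proof (rule K.finsum_cong')
        fix l assume "l \<in> {..<r}"
        then have l: "l < r" by simp
        show "(G (i, l) \<otimes>\<^bsub>D\<^esub> H (l, j)) x = d i (s (c l v) \<odot>\<^bsub>M\<^esub> e l)"
          using True cK[OF l]
          by (simp add: diff_op_ring_simps End_ring_def compose_eq G[OF i l] H[OF l j] flip: v_def)
      qed (use dD(1) sD(1) cK e in auto)
      also have "\<dots> = d i (\<Oplus>\<^bsub>rest t M\<^esub>l\<in>{..<r}. s (c l v) \<odot>\<^bsub>M\<^esub> e l)"
        by (rule T.functional_finsum[symmetric]) (use d[OF i] sD(1) cK e in auto)
      also have "\<dots> = d i v" using expand[OF v] by (simp add: finsum_rest)
      also have "\<dots> = x \<otimes> (if i = j then \<one> else \<zero>)"
        using dD(3)[OF True f[OF j]] dual[OF i j] by (simp add: v_def)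
      finally show ?thesis using True by (simp add: diff_op_ring_simps End_ring_def)
    next
      \<comment> \<open>Equality of operators is equality of functions, so values outside the
        carrier are compared as well; both are \<open>undefined\<close> by extensionality.\<close>
      case False
      have "?L \<in> carrier D" by (rule D.finsum_closed) (use LD in auto)
      then have "?L \<in> extensional (carrier K)" using End_contD(5)[OF diff_op_End_cont] by blast
      then show ?thesis using False by (simp add: extensional_def diff_op_ring_simps End_ring_def)
    qed
  qed
  then show ?thesis
    unfolding matrix_ring_def monoid.simps by (intro restrict_ext) auto
qed

end

subsection \<open>The residue field of a local ring\<close>

lemma residue_field_simps:
  "carrier (residue_field A) = carrier (A Quot max_ideal A)"
  "monoid.mult (residue_field A) = monoid.mult (A Quot max_ideal A)"
  "one (residue_field A) = one (A Quot max_ideal A)"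
  "ring.zero (residue_field A) = ring.zero (A Quot max_ideal A)"
  "ring.add (residue_field A) = ring.add (A Quot max_ideal A)"
  by (simp_all add: residue_field_def Let_def)

lemma residue_field_smult:
  "c \<odot>\<^bsub>residue_field A\<^esub> C = (\<Union>x\<in>C. max_ideal A +>\<^bsub>A\<^esub> (c \<odot>\<^bsub>A\<^esub> x))"
  by (simp add: residue_field_def Let_def)

context
  fixes k :: "'k ring" and A :: "('k, 'a) module"
  assumes kA: "algebra k A" and loc: "local_ring A"
begin

interpretation kA: algebra k A by (rule kA)
interpretation A: cring A by (rule kA.M_cring)
interpretation m: maximalideal "max_ideal A" A by (rule max_ideal_maximalideal[OF loc])

text \<open>The record shares its ring operations with \<open>A Quot max_ideal A\<close> but has
  another type, so the axioms of the quotient field are carried over.\<close>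

lemma residue_field_field: "field (residue_field A)"
proof -
  interpret Q: field "A Quot max_ideal A" by (rule m.quotient_is_field[OF kA.M_cring])
  have "cring (residue_field A)"
  proof (rule cringI)
    show "abelian_group (residue_field A)"
      by (rule abelian_groupI)
        (auto simp: residue_field_simps Q.a_assoc Q.a_lcomm Q.a_comm
          intro!: bexI[where x = "\<ominus>\<^bsub>A Quot max_ideal A\<^esub> _"] Q.l_neg)
    show "comm_monoid (residue_field A)"
      by (rule comm_monoidI) (simp_all add: residue_field_simps Q.m_assoc Q.m_comm Q.m_lcomm)
  qed (auto simp: residue_field_simps Q.l_distr)
  then show ?thesis
  proof (rule cring.cring_fieldI)
    have "Units (residue_field A) = Units (A Quot max_ideal A)"
      by (simp add: Units_def residue_field_simps)
    then show "Units (residue_field A) = carrier (residue_field A) - {\<zero>\<^bsub>residue_field A\<^esub>}"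
      using Q.field_Units by (simp add: residue_field_simps)
  qed
qed

lemma residue_map_ring_hom: "residue_map A \<in> ring_hom A (residue_field A)"
  using m.rcos_ring_hom
  unfolding residue_map_def[abs_def] ring_hom_def by (simp add: residue_field_simps)

lemma residue_map_image: "residue_map A ` carrier A = carrier (residue_field A)"
  by (auto simp: residue_field_simps FactRing_def A_RCOSETS_defs residue_map_def a_r_coset_def)

lemma residue_map_kernel: "a_kernel A (residue_field A) (residue_map A) = max_ideal A"
proof -
  have "residue_map A a = max_ideal A \<longleftrightarrow> a \<in> max_ideal A" if "a \<in> carrier A" for a
    using that m.a_rcos_const m.rcos_const_imp_mem unfolding residue_map_def by blast
  then show ?thesis
    using m.a_subset by (auto simp: a_kernel_def' residue_field_simps FactRing_def)
qed

text \<open>The scalar multiple of a coset is a union over representatives; the maximal ideal is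
  stable under \<open>k\<close>, so all of them yield the same coset.\<close>

lemma residue_map_smult:
  assumes c: "c \<in> carrier k" and a: "a \<in> carrier A"
  shows "residue_map A (c \<odot>\<^bsub>A\<^esub> a) = c \<odot>\<^bsub>residue_field A\<^esub> residue_map A a"
proof -
  have "max_ideal A +>\<^bsub>A\<^esub> (c \<odot>\<^bsub>A\<^esub> x) = max_ideal A +>\<^bsub>A\<^esub> (c \<odot>\<^bsub>A\<^esub> a)"
    if x: "x \<in> max_ideal A +>\<^bsub>A\<^esub> a" for x
  proof -
    obtain h where h: "h \<in> max_ideal A" "x = h \<oplus>\<^bsub>A\<^esub> a"
      using x by (auto simp: a_r_coset_def r_coset_def)
    have hA: "h \<in> carrier A" using h(1) m.Icarr by blast
    have "c \<odot>\<^bsub>A\<^esub> h = (c \<odot>\<^bsub>A\<^esub> \<one>\<^bsub>A\<^esub>) \<otimes>\<^bsub>A\<^esub> h"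
      using c hA by (simp add: kA.smult_assoc2)
    then have ch: "c \<odot>\<^bsub>A\<^esub> h \<in> max_ideal A" using m.I_l_closed[OF h(1)] c by simp
    have "c \<odot>\<^bsub>A\<^esub> x = c \<odot>\<^bsub>A\<^esub> h \<oplus>\<^bsub>A\<^esub> c \<odot>\<^bsub>A\<^esub> a" using c hA a h(2) by (simp add: kA.smult_r_distr)
    then have "c \<odot>\<^bsub>A\<^esub> x \<in> max_ideal A +>\<^bsub>A\<^esub> (c \<odot>\<^bsub>A\<^esub> a)"
      using ch by (auto simp: a_r_coset_def r_coset_def)
    then show ?thesis
      using abelian_group.a_repr_independence[OF kA.M.abelian_group_axioms _ _ m.a_subgroup, of "c \<odot>\<^bsub>A\<^esub> x" "c \<odot>\<^bsub>A\<^esub> a"] c a by simp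
  qed
  moreover have "a \<in> max_ideal A +>\<^bsub>A\<^esub> a" using m.a_rcos_self[OF a] .
  ultimately show ?thesis unfolding residue_field_smult residue_map_def by blast
qed

lemma residue_map_algebra_hom: "residue_map A \<in> algebra_homs k A (residue_field A)"
  using residue_map_ring_hom residue_map_smult by (simp add: algebra_homs_def)

text \<open>Each law holds for representatives in \<open>A\<close> and passes through the surjective
  residue map.\<close>

lemma residue_field_algebra: "algebra k (residue_field A)"
proof -
  let ?K = "residue_field A" and ?p = "residue_map A"
  interpret K: field ?K by (rule residue_field_field)
  note hom = residue_map_ring_hom
  have smul: "c \<odot>\<^bsub>?K\<^esub> ?p a = ?p (c \<odot>\<^bsub>A\<^esub> a)" if "c \<in> carrier k" "a \<in> carrier A" for c a
    using residue_map_smult[OF that] by simp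
  have pK: "?p a \<in> carrier ?K" if "a \<in> carrier A" for a using ring_hom_closed[OF hom that] .
  have ex: "\<exists>a\<in>carrier A. x = ?p a" if "x \<in> carrier ?K" for x
    using that unfolding residue_map_image[symmetric] by blast
  show ?thesis
  proof (rule algebraI)
    show "cring k" by (rule kA.R_cring)
    show "cring ?K" by (rule K.is_cring)
    fix c x assume c: "c \<in> carrier k" and x: "x \<in> carrier ?K"
    obtain a where a: "a \<in> carrier A" "x = ?p a" using ex[OF x] by blast
    show "c \<odot>\<^bsub>?K\<^esub> x \<in> carrier ?K" using a c by (simp add: smul pK)
    show "(c \<oplus>\<^bsub>k\<^esub> d) \<odot>\<^bsub>?K\<^esub> x = c \<odot>\<^bsub>?K\<^esub> x \<oplus>\<^bsub>?K\<^esub> d \<odot>\<^bsub>?K\<^esub> x" if "d \<in> carrier k" for d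
      using a c that by (simp add: smul kA.smult_l_distr ring_hom_add[OF hom])
    show "(c \<otimes>\<^bsub>k\<^esub> d) \<odot>\<^bsub>?K\<^esub> x = c \<odot>\<^bsub>?K\<^esub> (d \<odot>\<^bsub>?K\<^esub> x)" if "d \<in> carrier k" for d
      using a c that by (simp add: smul kA.smult_assoc1)
    fix y assume y: "y \<in> carrier ?K"
    obtain b where b: "b \<in> carrier A" "y = ?p b" using ex[OF y] by blast
    show "c \<odot>\<^bsub>?K\<^esub> (x \<oplus>\<^bsub>?K\<^esub> y) = c \<odot>\<^bsub>?K\<^esub> x \<oplus>\<^bsub>?K\<^esub> c \<odot>\<^bsub>?K\<^esub> y"
      using a b c by (simp add: smul kA.smult_r_distr flip: ring_hom_add[OF hom])
    show "c \<odot>\<^bsub>?K\<^esub> x \<otimes>\<^bsub>?K\<^esub> y = c \<odot>\<^bsub>?K\<^esub> (x \<otimes>\<^bsub>?K\<^esub> y)"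
      using a b c by (simp add: smul kA.smult_assoc2 flip: ring_hom_mult[OF hom])
  next
    fix x assume "x \<in> carrier ?K"
    then obtain a where "a \<in> carrier A" "x = ?p a" using ex by blast
    then show "\<one>\<^bsub>k\<^esub> \<odot>\<^bsub>?K\<^esub> x = x" by (simp add: smul)
  qed
qed

end

section \<open>Homomorphisms of modules in coordinates along two liftings\<close>

theorem theorem0p13:
  fixes k :: "'k ring"
    and A :: "('k, 'a) module" and TA :: "'a topology"
    and K :: "('k, 'a set) module" and TK :: "'a set topology"
    and \<sigma>1 \<sigma>2 :: "'a set \<Rightarrow> 'a"
    and M1 M2 :: "('a, 'm) module" and \<phi> :: "'m \<Rightarrow> 'm"
    and r1 r2 :: nat
    and \<psi>1 \<psi>2 :: "(nat \<Rightarrow> 'a set) \<Rightarrow> 'm"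
    and \<Phi> :: "nat \<times> nat \<Rightarrow> 'a set \<Rightarrow> 'a set"
  assumes k: "cring k" "\<one>\<^bsub>k\<^esub> \<noteq> \<zero>\<^bsub>k\<^esub>"
    and A: "precise_artinian_local_ring k A TA"
    and K: "K = residue_field A"
    and TK: "TK = residue_topology k A TA"
    and \<sigma>1: "lifting k A TA \<sigma>1"
    and \<sigma>2: "precise_lifting k A TA \<sigma>2"
    and M1: "finite_module A M1"
    and M2: "finite_module A M2"
    and \<phi>: "\<phi> \<in> linear_maps A M1 M2"
    and \<psi>1: "\<psi>1 \<in> linear_isos K (col_module K r1) (rest \<sigma>1 M1)"
    and \<psi>2: "\<psi>2 \<in> linear_isos K (col_module K r2) (rest \<sigma>2 M2)"
    and \<Phi>: "\<Phi> = hom_matrix K r2 r1 (inv_into (carrier (col_module K r2)) \<psi>2 \<circ> \<phi> \<circ> \<psi>1)"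
  shows "\<Phi> \<in> mats r2 r1 (carrier (diff_op_ring k K TK)) \<and>
    (M1 = M2 \<and> (\<forall>m\<in>carrier M1. \<phi> m = m) \<longrightarrow>
       r1 = r2 \<and> \<Phi> \<in> GL r1 (diff_op_ring k K TK))"
proof -
  have loc: "local_ring A" and art: "artinian_ring A" and stA: "st_ring k A TA"
    using A by (auto simp: precise_artinian_local_ring_def)
  have algA: "algebra k A" and TA: "topspace TA = carrier A"
    using stA by (auto simp: st_ring_def linear_topology_def)
  have cA: "cring A" by (rule algebra.M_cring[OF algA])
  let ?pr = "residue_map A" and ?D = "diff_op_ring k K TK"
  have algK: "algebra k K" and fieldK: "field K" and pr: "?pr \<in> algebra_homs k A K"
    and surj: "?pr ` carrier A = carrier K" and ker: "a_kernel A K ?pr = max_ideal A"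
    unfolding K using residue_field_algebra[OF algA loc] residue_field_field[OF algA loc]
      residue_map_algebra_hom[OF algA loc] residue_map_image[OF algA loc]
      residue_map_kernel[OF algA loc] .
  have cK: "cring K" by (rule algebra.M_cring[OF algK])
  \<comment> \<open>\<open>TK\<close> is given by a description operator; existence of the fine
    topology gives it the defining property, and surjectivity of the residue map makes
    \<open>K\<close> a ST ring.\<close>
  have "Module.module A (rest ?pr (self_module K))"
    using pr by (intro module_rest_ring_hom[OF cA cK] module_self_module cK) (simp add: algebra_homs_def)
  then have "is_fine_topology k A TA (rest ?pr (self_module K)) TK"
    unfolding TK residue_topology_def fine_topology_via_def K[symmetric]
    by (intro is_fine_topology_fine_topology algA TA)
  then have stK: "st_module k K TK (self_module K) TK"
    by (intro st_module_self_quotient[OF algA algK pr surj, of TA]) (simp add: is_fine_topology_def)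
  then have st: "st_algebra k K TK" using algK by (simp add: st_algebra_def)
  have topK: "topspace TK = carrier K" by (rule st_algebra.topspace_TK[OF st])
  obtain N where N: "ideal_pow A (a_kernel A K ?pr) N = {\<zero>\<^bsub>A\<^esub>}"
    unfolding ker by (rule artinian_local_nilpotent[OF art loc])
  have nil: "nilpotent_extension k K TK A M ?pr N" if "Module.module A M" for M :: "('a, 'm) module"
    using st algA fieldK pr that N by (simp add: nilpotent_extension_def nilpotent_extension_axioms_def)
  have mM1: "Module.module A M1" and mM2: "Module.module A M2"
    using M1 M2 by (auto simp: finite_module_def)
  have lift2: "lifting k A TA \<sigma>2" using \<sigma>2 by (simp add: precise_lifting_def)
  have cont1: "continuous_map TK TA \<sigma>1" using \<sigma>1 by (simp add: lifting_def TK)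
  have hom2: "\<sigma>2 \<in> ring_hom K A" using lift2 by (simp add: lifting_def algebra_homs_def K)
  have "Module.module K (rest \<sigma>2 (self_module A))"
    by (rule module_rest_ring_hom[OF cK cA hom2 module_self_module[OF cA]])
  \<comment> \<open>Preciseness is an equation with \<open>fine_topology\<close>, which becomes
    usable once that topology satisfies \<open>is_fine_topology\<close>.\<close>
  then have "is_fine_topology k K TK (rest \<sigma>2 (self_module A))
      (fine_topology k K TK (rest \<sigma>2 (self_module A)))"
    by (intro is_fine_topology_fine_topology algK topK)
  then have fine: "is_fine_topology k K TK (rest \<sigma>2 (self_module A)) TA"
    using \<sigma>2 unfolding precise_lifting_def fine_topology_via_def K TK by simp
  interpret N1: nilpotent_extension k K TK A M1 ?pr N by (rule nil[OF mM1])
  interpret N2: nilpotent_extension k K TK A M2 ?pr N by (rule nil[OF mM2])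
  have s1: "N1.retraction \<sigma>1" "N2.retraction \<sigma>1" and s2: "N2.retraction \<sigma>2"
    unfolding N1.retraction_def N2.retraction_def
    using \<sigma>1 lift2 by (simp_all add: lifting_def K)
  interpret S1: field_module K "rest \<sigma>1 M1" by (rule N1.field_module_rest[OF s1(1)])
  interpret S2: field_module K "rest \<sigma>2 M2" by (rule N2.field_module_rest[OF s2])
  let ?e1 = "S1.basis_vec r1 \<psi>1" and ?e2 = "S2.basis_vec r2 \<psi>2"
  let ?c1 = "S1.coord r1 \<psi>1" and ?c2 = "S2.coord r2 \<psi>2"
  note c1 = S1.functional_coord[OF \<psi>1, simplified] and c2 = S2.functional_coord[OF \<psi>2, simplified]
  note e1 = S1.basis_vec_closed[OF \<psi>1, simplified] and e2 = S2.basis_vec_closed[OF \<psi>2, simplified]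
  \<comment> \<open>Since \<open>\<phi>\<close> is \<open>A\<close>-linear it commutes with
    multiplication by \<open>\<sigma>1 x\<close>. The entry is therefore computed in
    \<open>M2\<close> alone, with the vector \<open>\<phi> (?e1 j)\<close> and a coordinate along
    \<open>\<sigma>2\<close>.\<close>
  have \<Phi>_entry: "\<Phi> (i, j) = (\<lambda>x\<in>carrier K. ?c2 i (\<sigma>1 x \<odot>\<^bsub>M2\<^esub> \<phi> (?e1 j)))"
    if "i < r2" "j < r1" for i j
  proof -
    have "inv_into (carrier (col_module K r2)) \<psi>2 (\<phi> (\<psi>1 (\<lambda>l\<in>{..<r1}. if l = j then x else \<zero>\<^bsub>K\<^esub>))) i
        = ?c2 i (\<sigma>1 x \<odot>\<^bsub>M2\<^esub> \<phi> (?e1 j))" if x: "x \<in> carrier K" for x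
    proof -
      have "\<phi> (\<psi>1 (\<lambda>l\<in>{..<r1}. if l = j then x else \<zero>\<^bsub>K\<^esub>)) = \<phi> (\<sigma>1 x \<odot>\<^bsub>M1\<^esub> ?e1 j)"
        using S1.psi_single[OF \<psi>1 x, of j] by simp
      also have "\<dots> = \<sigma>1 x \<odot>\<^bsub>M2\<^esub> \<phi> (?e1 j)"
        using \<phi> N1.retractionD(1)[OF s1(1) x] e1[of j] unfolding linear_maps_def by blast
      finally show ?thesis by (simp add: S2.coord_def[OF \<psi>2])
    qed
    then show ?thesis
      unfolding \<Phi> hom_matrix_def using that by (auto intro!: restrict_ext)
  qed
  have cont: "continuous_map TK TK (\<lambda>x. p (\<sigma>1 x \<odot>\<^bsub>M2\<^esub> n))"
    if "N2.functional \<sigma>2 (carrier M2) p" "n \<in> carrier M2" for p n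
    by (rule N2.continuous_entry_precise[OF TA fine s2 s1(2) cont1 that])
  have \<Phi>_D: "\<Phi> (i, j) \<in> carrier ?D" if "i < r2" "j < r1" for i j
  proof -
    have "\<phi> (?e1 j) \<in> carrier M2" using \<phi> e1 by (auto simp: linear_maps_def)
    then show ?thesis
      unfolding \<Phi>_entry[OF that]
      by (intro N2.entry_diff_op[OF s1(2) s2 c2[OF that(1)] cont] c2 that)
  qed
  have \<Phi>_mats: "\<Phi> \<in> mats r2 r1 (carrier ?D)"
    unfolding mats_def
  proof (rule PiE_I)
    show "\<Phi> z = undefined" if "z \<notin> {..<r2} \<times> {..<r1}" for z
      unfolding \<Phi> hom_matrix_def using that by (simp only: restrict_apply if_False)
  qed (use \<Phi>_D in auto)
  moreover have "r1 = r2 \<and> \<Phi> \<in> GL r1 ?D" if eq: "M1 = M2 \<and> (\<forall>m\<in>carrier M1. \<phi> m = m)"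
  proof -
    have M: "M1 = M2" and id: "\<And>m. m \<in> carrier M2 \<Longrightarrow> \<phi> m = m" using eq by auto
    \<comment> \<open>The \<open>r2\<close> coordinates along \<open>\<sigma>2\<close> bound the
      dimension along \<open>\<sigma>1\<close> after transfer; exchanging the liftings gives the
      other inequality.\<close>
    have "N2.separated \<sigma>1 r2 (carrier M2)"
      using S2.separated_carrier[OF \<psi>2] N2.separated_transfer[OF s2 s1(2) N2.M.carrier_is_submodule] by simp
    then have "r1 \<le> r2" using S1.separated_carrier_ge[OF \<psi>1] M by simp
    moreover have "N2.separated \<sigma>2 r1 (carrier M2)"
      using S1.separated_carrier[OF \<psi>1] N2.separated_transfer[OF s1(2) s2 N2.M.carrier_is_submodule] M by simp
    then have "r2 \<le> r1" using S2.separated_carrier_ge[OF \<psi>2] by simp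
    ultimately have r: "r1 = r2" by simp
    \<comment> \<open>The matrix of \<open>\<psi>2\<close> followed by the inverse of
      \<open>\<psi>1\<close>, written by entries of the same shape with the liftings
      exchanged.\<close>
    define \<Psi> where "\<Psi> = (\<lambda>(i, j)\<in>{..<r1} \<times> {..<r1}. \<lambda>x\<in>carrier K. ?c1 i (\<sigma>2 x \<odot>\<^bsub>M2\<^esub> ?e2 j))"
    have \<Psi>_entry: "\<Psi> (i, j) = (\<lambda>x\<in>carrier K. ?c1 i (\<sigma>2 x \<odot>\<^bsub>M2\<^esub> ?e2 j))" if "i < r1" "j < r1" for i j
      using that by (simp only: \<Psi>_def) simp
    note c1' = c1[unfolded M]
    \<comment> \<open>Preciseness of \<open>\<sigma>2\<close> enters through \<open>cont\<close>;
      the coordinates \<open>?c2\<close> are the separating functionals.\<close>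
    have "continuous_map TK TK (\<lambda>x. ?c1 i (\<sigma>2 x \<odot>\<^bsub>M2\<^esub> n))" if "i < r1" "n \<in> carrier M2" for i n
      by (rule N2.continuous_inverse_entry[OF s1(2) s2 c1'[OF that(1)] cont c2 _ that(2)])
        (use S2.coord_separating[OF \<psi>2] in auto)
    then have \<Psi>_D: "\<Psi> (i, j) \<in> carrier ?D" if "i < r1" "j < r1" for i j
      unfolding \<Psi>_entry[OF that] using that(1)
      by (intro N2.entry_diff_op[OF s2 s1(2) c1'[OF that(1)] _ e2]) auto
    have \<Phi>_entry': "\<Phi> (i, j) = (\<lambda>x\<in>carrier K. ?c2 i (\<sigma>1 x \<odot>\<^bsub>M2\<^esub> ?e1 j))" if "i < r1" "j < r1" for i j
      using \<Phi>_entry[of i j] id[OF e1[unfolded M]] that r by simp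
    \<comment> \<open>This product uses expansion along \<open>\<sigma>1\<close> and duality along
      \<open>\<sigma>2\<close>; the product in the other order swaps the two.\<close>
    have "\<Phi> \<otimes>\<^bsub>matrix_ring r1 ?D\<^esub> \<Psi> = \<one>\<^bsub>matrix_ring r1 ?D\<^esub>"
    proof (rule N2.transition_matrices_inverse[OF s1(2) s2, where c = ?c1 and e = ?e1 and d = ?c2 and f = ?e2])
      show "v = (\<Oplus>\<^bsub>M2\<^esub>l\<in>{..<r1}. \<sigma>1 (?c1 l v) \<odot>\<^bsub>M2\<^esub> ?e1 l)" if "v \<in> carrier M2" for v
        using S1.coord_expand[OF \<psi>1] that by (simp add: finsum_rest M)
    qed (use e1 e2 c1 c2 S2.coord_basis_vec[OF \<psi>2] \<Phi>_entry' \<Psi>_entry \<Phi>_D \<Psi>_D in \<open>simp_all add: r M\<close>)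
    moreover have "\<Psi> \<otimes>\<^bsub>matrix_ring r1 ?D\<^esub> \<Phi> = \<one>\<^bsub>matrix_ring r1 ?D\<^esub>"
    proof (rule N2.transition_matrices_inverse[OF s2 s1(2), where c = ?c2 and e = ?e2 and d = ?c1 and f = ?e1])
      show "v = (\<Oplus>\<^bsub>M2\<^esub>l\<in>{..<r1}. \<sigma>2 (?c2 l v) \<odot>\<^bsub>M2\<^esub> ?e2 l)" if "v \<in> carrier M2" for v
        using S2.coord_expand[OF \<psi>2] that by (simp add: finsum_rest r)
    qed (use e1 e2 c1 c2 S1.coord_basis_vec[OF \<psi>1] \<Phi>_entry' \<Psi>_entry \<Phi>_D \<Psi>_D in \<open>simp_all add: r M\<close>)
    moreover have "\<Psi> \<in> mats r1 r1 (carrier ?D)"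
      unfolding mats_def
    proof (rule PiE_I)
      show "\<Psi> z = undefined" if "z \<notin> {..<r1} \<times> {..<r1}" for z
        unfolding \<Psi>_def using that by (simp only: restrict_apply if_False)
    qed (use \<Psi>_D in auto)
    moreover have "\<Phi> \<in> mats r1 r1 (carrier ?D)" using \<Phi>_mats r by simp
    ultimately have "\<Phi> \<in> GL r1 ?D"
      unfolding GL_def Units_def by (auto simp: matrix_ring_def)
    with r show ?thesis by blast
  qed
  ultimately show ?thesis by blast
qed

end
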